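(* Let $G$ be a graph with $n\ge 8$ vertices, and write $n=5t+r$ with $t$ a positive integer and $r\in\{0,1,2,3,4\}$. Then $\phi(G)\le 10^t$ if $r=0$; $\phi(G)\le 15\cdot 10^{t-1}$ if $r=1$; $\phi(G)\le 225\cdot 10^{t-2}$ if $r=2$; $\phi(G)\le 36\cdot 10^{t-1}$ if $r=3$; $\phi(G)\le 6\cdot 10^{t}$ if $r=4$. Equality holds if and only if $G\cong tK_5^*$ (for $r=0$), $G\cong K_6^*\cup(t-1)K_5^*$ (for $r=1$), $G\cong 2K_6^*\cup(t-2)K_5^*$ (for $r=2$), $G\cong 2K_4^*\cup(t-1)K_5^*$ (for $r=3$), $G\cong K_4^*\cup tK_5^*$ (for $r=4$), where each occurrence of $K_m^*$ may independently be any graph of the stated form.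
   Context: A subset $F$ of vertices of a graph $G$ is a dissociation set if $G[F]$ has maximum degree at most $1$; a maximal dissociation set is one not properly contained in another dissociation set; $\phi(G)$ is the number of maximal dissociation sets of $G$. $K_m^*$ denotes any graph obtained from the complete graph $K_m$ by deleting $i$ pairwise non-adjacent edges (a matching of size $i$) for some $0\le i\le m/2$. $\ell H$ denotes the disjoint union of $\ell$ copies of $H$ and $\cup$ denotes disjoint union. *)

theory Defs
  imports Main "HOL-Library.Multiset" "HOL-Library.Disjoint_Sets"
begin

definition simple_graph :: "'a set \<Rightarrow> ('a \<Rightarrow> 'a \<Rightarrow> bool) \<Rightarrow> bool" where
  "simple_graph V adj \<longleftrightarrow> finite V \<and>
     (\<forall>x y. adj x y \<longrightarrow> x \<in> V \<and> y \<in> V) \<and>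
     (\<forall>x y. adj x y \<longrightarrow> adj y x) \<and> (\<forall>x. \<not> adj x x)"

definition dissociation_set :: "'a set \<Rightarrow> ('a \<Rightarrow> 'a \<Rightarrow> bool) \<Rightarrow> 'a set \<Rightarrow> bool" where
  "dissociation_set V adj F \<longleftrightarrow> F \<subseteq> V \<and> (\<forall>x\<in>F. card {y \<in> F. adj x y} \<le> 1)"

definition maximal_dissociation_set :: "'a set \<Rightarrow> ('a \<Rightarrow> 'a \<Rightarrow> bool) \<Rightarrow> 'a set \<Rightarrow> bool" where
  "maximal_dissociation_set V adj F \<longleftrightarrow> dissociation_set V adj F \<and>
     \<not> (\<exists>F'. dissociation_set V adj F' \<and> F \<subset> F')"

definition phi :: "'a set \<Rightarrow> ('a \<Rightarrow> 'a \<Rightarrow> bool) \<Rightarrow> nat" where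
  "phi V adj = card {F. maximal_dissociation_set V adj F}"

definition is_Kstar :: "('a \<Rightarrow> 'a \<Rightarrow> bool) \<Rightarrow> 'a set \<Rightarrow> bool" where
  "is_Kstar adj P \<longleftrightarrow> (\<exists>M. M \<subseteq> {e. \<exists>x y. e = {x, y} \<and> x \<in> P \<and> y \<in> P \<and> x \<noteq> y} \<and>
      (\<forall>e1\<in>M. \<forall>e2\<in>M. e1 \<noteq> e2 \<longrightarrow> e1 \<inter> e2 = {}) \<and>
      (\<forall>x\<in>P. \<forall>y\<in>P. adj x y \<longleftrightarrow> x \<noteq> y \<and> {x, y} \<notin> M))"

text \<open>The graph (V, adj) is isomorphic to a disjoint union of graphs K_m^*, one for
  each m in the multiset sizes (with multiplicity), each independently of the stated form.\<close>
definition is_union_Kstar :: "'a set \<Rightarrow> ('a \<Rightarrow> 'a \<Rightarrow> bool) \<Rightarrow> nat multiset \<Rightarrow> bool" where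
  "is_union_Kstar V adj sizes \<longleftrightarrow> (\<exists>\<P>. partition_on V \<P> \<and> finite \<P> \<and>
      (\<forall>P\<in>\<P>. \<forall>Q\<in>\<P>. P \<noteq> Q \<longrightarrow> (\<forall>x\<in>P. \<forall>y\<in>Q. \<not> adj x y)) \<and>
      (\<forall>P\<in>\<P>. is_Kstar adj P) \<and>
      image_mset card (mset_set \<P>) = sizes)"

end

theory Submission
  imports Defs
begin

text \<open>
  Disjoint unions multiply the number of maximal dissociation sets, so one may assume that the graph
  is connected. Every maximal dissociation set F distributes weight to the vertices so that each of
  them receives at least 2: an edge uv of G[F] gives 2 to all of N(u) and N(v), together s vertices,
  and an isolated vertex of G[F] gives 2 to itself and 1 to each neighbour that no edge of G[F]
  dominates. Summing up, 2 n phi(G) is at most the total weight sent out by all vertices. The weight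
  sent out by v is bounded through the induction hypothesis, since the sets F containing a given
  edge uv correspond to maximal dissociation sets of the graph on the remaining n - s vertices, and
  similarly for isolated v. The outcome is at most twice the claimed maximum, with equality only if
  v has at most one non-neighbour. So a connected extremal graph is complete up to a matching, and
  the optimal component sizes are found by elementary arithmetic.
\<close>

section \<open>The extremal function\<close>

text \<open>The weights are chosen so that nothing is lost on the extremal components: in a K_m^*
  with m at least 2, every vertex receives exactly 2 from each maximal set, and every vertex sends
  out m(m-1). The estimate for a vertex v of degree d with m non-neighbours rests on a trade-off. If
  an edge uv of G[F] dominates e of the non-neighbours, it rewards d + 1 + e vertices but leaves
  only m - e vertices for the rest of F, and the extremal function grows fast enough for the loss to
  prevail. The obstacle is the sets in which v is isolated. Bounding their number by the extremal
  value at m suffices for d at least 6 but not below: d = 5, m = 6 yields 455, where the estimate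
  must stay below 450. What helps is that each neighbour u of v, being excluded, must be blocked by
  a vertex beyond N[v]. There is no such set if u has no neighbour there, and if w is the only one,
  every such set contains w. Small values need separate checks throughout, because the recursion by
  the factor 10 is valid only from 8 on.\<close>

text \<open>The maximum of the product of the numbers m choose 2 (read as 1 for m = 1) over all ways
  to write n as a sum of positive integers m.\<close>
fun diss_max :: "nat \<Rightarrow> nat" where
  "diss_max n = (if n < 13 then [1,1,1,3,6,10,15,21,36,60,100,150,225] ! n else 10 * diss_max (n - 5))"

declare diss_max.simps [simp del]

lemma diss_max_add5: "8 \<le> n \<Longrightarrow> diss_max (n + 5) = 10 * diss_max n"
proof (cases "n < 13")
  case True
  assume "8 \<le> n"
  with True have "n \<in> {8,9,10,11,12}" by auto
  then show ?thesis by (auto simp: diss_max.simps)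
qed (simp add: diss_max.simps[of "n+5"])

lemma diss_max_table [simp]:
  "diss_max 0 = 1" "diss_max (Suc 0) = 1" "diss_max (Suc (Suc 0)) = 1"
  "diss_max (Suc (Suc (Suc 0))) = 3" "diss_max 2 = 1" "diss_max 3 = 3" "diss_max 4 = 6"
  "diss_max 5 = 10" "diss_max 6 = 15" "diss_max 7 = 21" "diss_max 8 = 36" "diss_max 9 = 60"
  "diss_max 10 = 100" "diss_max 11 = 150" "diss_max 12 = 225" "diss_max 13 = 360"
  "diss_max 14 = 600" "diss_max 15 = 1000" "diss_max 16 = 1500" "diss_max 17 = 2250"
  "diss_max 18 = 3600" "diss_max 19 = 6000" "diss_max 20 = 10000" "diss_max 21 = 15000"
  "diss_max 22 = 22500" "diss_max 23 = 36000" "diss_max 24 = 60000" "diss_max 25 = 100000"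
  by (simp_all add: diss_max.simps)

text \<open>Both sides of a linear inequality between shifted values are multiplied by 10 when
  \<open>n\<close> grows by 5, so checking it below 13 suffices. The step starts at 8 because 21 at
  7 is followed by 225, not 210, at 12.\<close>

lemma diss_max_induct:
  assumes base: "\<And>n. n < 13 \<Longrightarrow> P n" and step: "\<And>n. 8 \<le> n \<Longrightarrow> P n \<Longrightarrow> P (n + 5)"
  shows "P (n::nat)"
proof (induction n rule: less_induct)
  case (less n)
  show ?case
  proof (cases "n < 13")
    case False
    then have "P (n - 5 + 5)" by (intro step less) auto
    then show ?thesis using False by simp
  qed (rule base)
qed

lemma less13_cases:
  "(n::nat) < 13 \<Longrightarrow> n = 0 \<or> n = Suc 0 \<or> n = 2 \<or> n = 3 \<or> n = 4 \<or> n = 5 \<or> n = 6 \<or> n = 7 \<or> n = 8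
    \<or> n = 9 \<or> n = 10 \<or> n = 11 \<or> n = 12"
  by (simp add: eval_nat_numeral less_Suc_eq)

lemma diss_max_step:
  assumes "8 \<le> n"
  shows "diss_max (n + 5) = 10 * diss_max n" "diss_max (n + 6) = 10 * diss_max (n + 1)"
    "diss_max (6 + n) = 10 * diss_max (n + 1)" "diss_max (7 + n) = 10 * diss_max (n + 2)"
    "diss_max (n + 7) = 10 * diss_max (n + 2)" "diss_max (n + 8) = 10 * diss_max (n + 3)"
    "diss_max (n + 9) = 10 * diss_max (n + 4)" "diss_max (n + 10) = 10 * diss_max (n + 5)"
    "diss_max (n + 11) = 10 * diss_max (n + 6)" "diss_max (n + 12) = 10 * diss_max (n + 7)"
    "diss_max (n + 13) = 10 * diss_max (n + 8)" "diss_max (n + 14) = 10 * diss_max (n + 9)"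
    "diss_max (n + 15) = 10 * diss_max (n + 10)" "diss_max (n + 16) = 10 * diss_max (n + 11)"
    "diss_max (n + 17) = 10 * diss_max (n + 12)"
  using assms diss_max_add5[of n] diss_max_add5[of "n+1"] diss_max_add5[of "n+2"] diss_max_add5[of "n+3"]
    diss_max_add5[of "n+4"] diss_max_add5[of "n+5"] diss_max_add5[of "n+6"] diss_max_add5[of "n+7"]
    diss_max_add5[of "n+8"] diss_max_add5[of "n+9"] diss_max_add5[of "n+10"]
    diss_max_add5[of "n+11"] diss_max_add5[of "n+12"]
  by (simp_all add: eval_nat_numeral)

section \<open>Supermultiplicativity and growth of the extremal function\<close>

lemma diss_max_pos: "0 < diss_max n"
proof (induction n rule: diss_max_induct)
  case (1 n) then show ?case by (auto dest!: less13_cases)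
next
  case (2 n) then show ?case by (simp add: diss_max_add5)
qed

lemma diss_max_mono_Suc: "diss_max n \<le> diss_max (n + 1)"
proof (induction n rule: diss_max_induct)
  case (1 n) then show ?case by (auto dest!: less13_cases)
next
  case (2 n) then show ?case using diss_max_step[OF 2(1)] by (simp add: add.assoc)
qed

lemma diss_max_mono: "m \<le> n \<Longrightarrow> diss_max m \<le> diss_max n"
  by (rule lift_Suc_mono_le[of diss_max]) (use diss_max_mono_Suc in auto)

lemma diss_max_supermult: "diss_max a * diss_max b \<le> diss_max (a + b)"
proof (induction a rule: diss_max_induct)
  case (1 a)
  show ?case
  proof (induction b rule: diss_max_induct)
    case (1 b)
    then show ?case using \<open>a < 13\<close> by (auto dest!: less13_cases)
  next
    case (2 b)
    then show ?case using diss_max_add5[of b] diss_max_add5[of "a+b"] by (simp add: add.assoc[symmetric])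
  qed
next
  case (2 a)
  then show ?case using diss_max_add5[of a] diss_max_add5[of "a+b"]
    by (simp add: add.assoc add.commute[of b])
qed

text \<open>Half of the left-hand side is the number of pairs among \<open>n + 1\<close> vertices, a
  single factor in the maximum. Being quadratic, it grows at most tenfold when \<open>n\<close>
  increases from 8 or more by 5.\<close>

lemma sq_le_diss_max: "n * (n + 1) \<le> 2 * diss_max (n + 1)"
proof (induction n rule: diss_max_induct)
  case (1 n) then show ?case by (auto dest!: less13_cases)
next
  case (2 n)
  have "(n + 5) * (n + 5 + 1) \<le> 10 * (n * (n + 1))"
    using 2(1) by (auto simp: le_iff_add algebra_simps)
  also have "\<dots> \<le> 10 * (2 * diss_max (n + 1))" using 2(2) by (rule mult_le_mono2)
  also have "\<dots> = 2 * diss_max (n + 5 + 1)" using diss_max_step(3)[OF 2(1)] by (simp add: add.assoc)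
  finally show ?case .
qed

lemma diss_max_ge_self: "3 \<le> n \<Longrightarrow> n \<le> diss_max n"
proof (induction n rule: diss_max_induct)
  case (1 n) then show ?case by (auto dest!: less13_cases)
next
  case (2 n) then show ?case by (simp add: diss_max_add5)
qed

text \<open>The ratio 7/5 is attained between 6 and 7, where the values are 15 and 21. Below 2 there
  is no growth at all.\<close>

lemma diss_max_gap1: "2 \<le> n \<Longrightarrow> 7 * diss_max n \<le> 5 * diss_max (n + 1)"
proof (induction n rule: diss_max_induct)
  case (1 n) then show ?case by (auto dest!: less13_cases)
next
  case (2 n) then show ?case using diss_max_step[OF 2(1)] by (simp add: add.assoc)
qed

lemma diss_max_gap2: "1 \<le> n \<Longrightarrow> 5 * diss_max n < 3 * diss_max (n + 2)"
proof (induction n rule: diss_max_induct)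
  case (1 n) then show ?case by (auto dest!: less13_cases)
next
  case (2 n) then show ?case using diss_max_step[OF 2(1)] by (simp add: add.assoc)
qed

text \<open>The trade-off: \<open>i\<close> more dominated vertices are rewarded, but
  \<open>i\<close> vertices are lost for the rest. The surplus \<open>s - 3\<close> is covered by
  monotonicity, so \<open>s = 3\<close> suffices; there the two gap lemmas settle
  \<open>i = 1\<close> and \<open>i = 2\<close>, and \<open>3 + i < 3 * diss_max i\<close> with
  supermultiplicativity settles the others.\<close>

lemma weighted_diss_max_less:
  assumes "3 \<le> s" "3 \<le> k" "0 < i" "i \<le> k"
  shows "(s + i) * diss_max (k - i) < s * diss_max k"
proof -
  have *: "(3 + i) * diss_max (k - i) < 3 * diss_max k"
  proof -
    consider "i = 1" | "i = 2" | "3 \<le> i" using assms by linarith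
    then show ?thesis
    proof cases
      case 1
      then show ?thesis using diss_max_gap1[of "k - 1"] assms diss_max_pos[of k]
        by (cases k) auto
    next
      case 2
      moreover obtain l where "k = l + 3" using assms(2) by (auto simp: le_iff_add)
      ultimately show ?thesis using diss_max_gap2[of "l + 1"] by (simp add: numeral_eq_Suc)
    next
      case 3
      have "3 + i < 3 * diss_max i" using diss_max_ge_self[OF 3] 3 by linarith
      then have "(3 + i) * diss_max (k - i) < 3 * diss_max i * diss_max (k - i)"
        using diss_max_pos by simp
      also have "\<dots> \<le> 3 * diss_max k" using diss_max_supermult[of i "k - i"] assms by simp
      finally show ?thesis .
    qed
  qed
  have "(s - 3) * diss_max (k - i) \<le> (s - 3) * diss_max k" by (simp add: diss_max_mono)
  with * have "(s - 3 + (3 + i)) * diss_max (k - i) < (s - 3 + 3) * diss_max k"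
    by (simp only: distrib_right)
  then show ?thesis using assms by (simp add: ac_simps)
qed

lemma weighted_diss_max_le:
  assumes "3 \<le> s" "3 \<le> k" "i \<le> k"
  shows "(s + i) * diss_max (k - i) \<le> s * diss_max k"
  using weighted_diss_max_less[OF assms(1,2)] assms(3) by (cases "i = 0") (auto intro: less_imp_le)

text \<open>In the lemmas numeric_through, numeric_large_degree and numeric_many_escapes, d is the degree of
  a vertex v with j + 4 non-neighbours, so that the graph has j + 5 + d vertices. The left-hand sides
  are bounds for the weight that v sends out.\<close>
lemma numeric_through_1: "d \<in> {1,2,3,4,5} \<Longrightarrow> 7 * (d * (d + 2)) * diss_max (j+3) + 4 * (d + 2) * diss_max (j+4) < 14 * diss_max (j + 5 + d)"
proof (induction j rule: diss_max_induct)
  case (1 n) then show ?case by (auto dest!: less13_cases)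
next
  case (2 n) then show ?case using diss_max_step[OF 2(1)] by (auto simp: add.assoc)
qed

lemma numeric_through_2: "d \<in> {1,2,3,4,5} \<Longrightarrow> d * (d + 2) * diss_max (j+3) + (d + 2) * (diss_max (j+1) + 2 * diss_max j) < 2 * diss_max (j + 5 + d)"
proof (induction j rule: diss_max_induct)
  case (1 n) then show ?case by (auto dest!: less13_cases)
next
  case (2 n) then show ?case using diss_max_step[OF 2(1)] by (auto simp: add.assoc)
qed

lemma numeric_through_3: "d \<in> {1,2,3,4,5} \<Longrightarrow> d * (d + 2) * diss_max (j+3) + (d + 2) * (diss_max (j+2) + diss_max j) < 2 * diss_max (j + 5 + d)"
proof (induction j rule: diss_max_induct)
  case (1 n) then show ?case by (auto dest!: less13_cases)
next
  case (2 n) then show ?case using diss_max_step[OF 2(1)] by (auto simp: add.assoc)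
qed

lemma numeric_through_4:
  assumes d: "d \<in> {1,2,3,4,5}" and s: "1 \<le> s" "s \<le> j + 2"
  shows "d * (d + 2) * diss_max (j+3) + (d + 2) * (s * diss_max (j+2-s) + diss_max (j+1)) < 2 * diss_max (j + 5 + d)"
proof -
  have one: "d * (d + 2) * diss_max (j+3) + (d + 2) * (diss_max (j+1) + diss_max (j+1)) < 2 * diss_max (j + 5 + d)"
    using d
  proof (induction j rule: diss_max_induct)
    case (1 n) then show ?case by (auto dest!: less13_cases)
  next
    case (2 n) then show ?case using diss_max_step[OF 2(1)] by (auto simp: add.assoc)
  qed
  have two: "d * (d + 2) * diss_max (j+3) + (d + 2) * (2 * diss_max j + diss_max (j+1)) < 2 * diss_max (j + 5 + d)"
    using d
  proof (induction j rule: diss_max_induct)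
    case (1 n) then show ?case by (auto dest!: less13_cases)
  next
    case (2 n) then show ?case using diss_max_step[OF 2(1)] by (auto simp: add.assoc)
  qed
  have three: "d * (d + 2) * diss_max (i+4) + (d + 2) * (3 * diss_max i + diss_max (i+2)) < 2 * diss_max (i + 6 + d)" for i
    using d
  proof (induction i rule: diss_max_induct)
    case (1 n) then show ?case by (auto dest!: less13_cases)
  next
    case (2 n) then show ?case using diss_max_step[OF 2(1)] by (auto simp: add.assoc)
  qed
  \<comment> \<open>Beyond 3 the trade-off makes \<open>s = 3\<close> the worst case. It needs
    \<open>j - 1\<close> to be at least 3, so \<open>j < 4\<close> is evaluated directly.\<close>
  consider "s = 1" | "s = 2" | "3 \<le> s" "j < 4" | "3 \<le> s" "4 \<le> j" using s by linarith
  then show ?thesis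
  proof cases
    case 1 then show ?thesis using one by simp
  next
    case 2 then show ?thesis using two by simp
  next
    case 3
    then have "j \<in> {0,1,2,3}" "s \<in> {3,4,5}" using s by auto
    then show ?thesis using d s by auto
  next
    case 4
    have "s * diss_max (j + 2 - s) \<le> 3 * diss_max (j - 1)"
      using weighted_diss_max_le[of 3 "j - 1" "s - 3"] 4 s by simp
    then have "(d + 2) * (s * diss_max (j+2-s) + diss_max (j+1)) \<le> (d + 2) * (3 * diss_max (j - 1) + diss_max (j+1))"
      by (intro mult_le_mono2 add_right_mono)
    moreover have eqs: "j - 1 + 4 = j + 3" "j - 1 + 2 = j + 1" "j - 1 + 6 + d = j + 5 + d" using 4 by auto
    ultimately show ?thesis using three[of "j - 1", unfolded eqs] by linarith
  qed
qed

lemma numeric_large_degree: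
  assumes "6 \<le> d"
  shows "d * ((d + 2) * diss_max (j + 3)) + (d + 2) * diss_max (j + 4) < 2 * diss_max (j + 5 + d)"
proof (cases "d = 6")
  case True
  have "48 * diss_max (j + 3) + 8 * diss_max (j + 4) < 2 * diss_max (j + 11)"
  proof (induction j rule: diss_max_induct)
    case (1 n) then show ?case by (auto dest!: less13_cases)
  next
    case (2 n) then show ?case using diss_max_step[OF 2(1)] by (auto simp: add.assoc)
  qed
  then show ?thesis using True by (simp add: add.commute)
next
  case False
  \<comment> \<open>At 6 this just fails, 296 against 294, hence the separate treatment of that
    degree.\<close>
  have aux: "7 \<le> d \<Longrightarrow> (d + 2) * (5 * d + 7) < 14 * diss_max (d + 1)" for d
  proof (induction d rule: diss_max_induct)
    case (1 n) then show ?case by (auto dest!: less13_cases)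
  next
    case (2 n)
    have "(n + 5 + 2) * (5 * (n + 5) + 7) \<le> 10 * ((n + 2) * (5 * n + 7))"
      using 2(1) by (simp add: algebra_simps trans_le_add1)
    then show ?case using 2 diss_max_step(3)[OF 2(1)] by (simp add: add.assoc)
  qed
  have "7 * (d * ((d + 2) * diss_max (j + 3)) + (d + 2) * diss_max (j + 4))
      = (d * (d + 2)) * (7 * diss_max (j + 3)) + 7 * (d + 2) * diss_max (j + 4)" by (simp add: algebra_simps)
  also have "\<dots> \<le> (d * (d + 2)) * (5 * diss_max (j + 4)) + 7 * (d + 2) * diss_max (j + 4)"
    using diss_max_gap1[of "j + 3"] by (intro add_right_mono mult_le_mono2) (simp add: ac_simps)
  also have "\<dots> = (d + 2) * (5 * d + 7) * diss_max (j + 4)" by (simp add: algebra_simps)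
  also have "\<dots> < 14 * diss_max (d + 1) * diss_max (j + 4)"
    using aux[of d] False assms diss_max_pos by simp
  also have "\<dots> \<le> 14 * diss_max (j + 5 + d)"
    using diss_max_supermult[of "d+1" "j+4"] by (simp add: ac_simps)
  finally show ?thesis by simp
qed

text \<open>The ratio 4/7 is attained at \<open>d = 2\<close>, \<open>m = 7\<close>, where 2 * 6 =
  12 stands against 21. From \<open>d = 3\<close> on, the pair count of
  \<open>sq_le_diss_max\<close> even gives 1/2. This bounds the sets through a vertex of degree
  \<open>d\<close> one of whose neighbours has no neighbour outside its closed
  neighbourhood.\<close>

lemma numeric_closed_neighbour:
  assumes "4 \<le> m" "1 \<le> d" "d < m"
  shows "7 * (d * diss_max (m - d - 1)) \<le> 4 * diss_max m"
proof -
  have one: "7 * diss_max (j + 2) \<le> 4 * diss_max (j + 4)" for j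
  proof (induction j rule: diss_max_induct)
    case (1 n) then show ?case by (auto dest!: less13_cases)
  next
    case (2 n) then show ?case using diss_max_step[OF 2(1)] by (auto simp: add.assoc)
  qed
  have two: "14 * diss_max (j + 1) \<le> 4 * diss_max (j + 4)" for j
  proof (induction j rule: diss_max_induct)
    case (1 n) then show ?case by (auto dest!: less13_cases)
  next
    case (2 n) then show ?case using diss_max_step[OF 2(1)] by (auto simp: add.assoc)
  qed
  obtain k where k: "m = k + 4" using assms(1) by (auto simp: le_iff_add)
  consider "d = 1" | "d = 2" | "3 \<le> d" using assms by linarith
  then show ?thesis
  proof cases
    case 1 then show ?thesis using one[of k] k by (simp add: numeral_eq_Suc)
  next
    case 2 then show ?thesis using two[of k] k by (simp add: numeral_eq_Suc)
  next
    case 3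
    have "4 * (d * diss_max (m - d - 1)) \<le> (d * (d + 1)) * diss_max (m - d - 1)" using 3 by simp
    also have "\<dots> \<le> 2 * diss_max (d + 1) * diss_max (m - d - 1)"
      using sq_le_diss_max[of d] by (rule mult_le_mono1)
    also have "\<dots> \<le> 2 * diss_max m" using diss_max_supermult[of "d + 1" "m - d - 1"] assms by simp
    finally show ?thesis by linarith
  qed
qed

text \<open>The first summand stands for the sets in which the vertex is isolated, the second for
  its \<open>d\<close> possible partners, each of which dominates a further vertex. For degrees 1
  and 2 the ratio 4/7 is exceeded (9 of 15 at \<open>m = 6\<close>, 22 of 36 at
  \<open>m = 8\<close>), which is why \<open>through_bound\<close> has further alternatives.\<close>

lemma numeric_open_neighbours:
  assumes "3 \<le> d" "d + 2 \<le> m"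
  shows "7 * (diss_max (m - d - 1) + d * diss_max (m - d - 2)) \<le> 4 * diss_max m"
proof (cases "d = 3")
  case True
  have "7 * (diss_max (j + 1) + 3 * diss_max j) \<le> 4 * diss_max (j + 5)" for j
  proof (induction j rule: diss_max_induct)
    case (1 n) then show ?case by (auto dest!: less13_cases)
  next
    case (2 n) then show ?case using diss_max_step[OF 2(1)] by (auto simp: add.assoc)
  qed
  moreover have "5 \<le> m" using assms True by simp
  then obtain k where "m = k + 5" by (auto simp: le_iff_add)
  ultimately show ?thesis using True by (simp add: numeral_eq_Suc)
next
  case False
  have "2 * (diss_max (m - d - 1) + d * diss_max (m - d - 2)) \<le> 2 * ((d + 1) * diss_max (m - d - 1))"
    using diss_max_mono[of "m - d - 2" "m - d - 1"] by simp
  then have "2 * (2 * (diss_max (m - d - 1) + d * diss_max (m - d - 2))) \<le> 4 * (d + 1) * diss_max (m - d - 1)"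
    by (simp add: algebra_simps)
  also have "\<dots> \<le> d * (d + 1) * diss_max (m - d - 1)"
    using False assms by (intro mult_le_mono1) simp
  also have "\<dots> \<le> 2 * diss_max (d + 1) * diss_max (m - d - 1)"
    using sq_le_diss_max[of d] by (rule mult_le_mono1)
  also have "\<dots> \<le> 2 * diss_max m" using diss_max_supermult[of "d + 1" "m - d - 1"] assms by simp
  finally show ?thesis by linarith
qed

lemma numeric_many_escapes:
  assumes d: "d \<in> {1,2,3,4,5}"
  shows "\<exists>T. (\<forall>e b. 2 \<le> e \<longrightarrow> e \<le> j + 4 \<longrightarrow> b \<le> diss_max (j + 4) \<longrightarrow> b \<le> e * diss_max (j + 2) \<longrightarrow>
      (d + 1 + e) * diss_max (j + 4 - e) + b \<le> T) \<and> d * T + 2 * diss_max (j + 4) < 2 * diss_max (j + 5 + d)"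
proof -
  consider "j = 0" | "j = 1" | "2 \<le> j" by linarith
  then show ?thesis
  proof cases
    case 1
    have "(d + 1 + e) * diss_max (j + 4 - e) + b \<le> d + 11" if "2 \<le> e" "e \<le> j + 4" "b \<le> diss_max (j + 4)" for e b
    proof -
      have "e \<in> {2,3,4}" using that 1 by auto
      then show ?thesis using that 1 by auto
    qed
    moreover have "d * (d + 11) + 2 * diss_max (j + 4) < 2 * diss_max (j + 5 + d)" using d 1 by auto
    ultimately show ?thesis by blast
  next
    case 2
    have "(d + 1 + e) * diss_max (j + 4 - e) + b \<le> 3 * d + 15"
      if "2 \<le> e" "e \<le> j + 4" "b \<le> diss_max (j + 4)" "b \<le> e * diss_max (j + 2)" for e b
    proof -
      have "e \<in> {2,3,4,5}" using that 2 by auto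
      then show ?thesis using that 2 d by auto
    qed
    moreover have "d * (3 * d + 15) + 2 * diss_max (j + 4) < 2 * diss_max (j + 5 + d)" using d 2 by auto
    ultimately show ?thesis by blast
  next
    case 3
    \<comment> \<open>The first entry is the case \<open>e = 2\<close>, with \<open>b\<close> at
      most \<open>2 * diss_max (j + 2)\<close>. The second is \<open>e = 3\<close>, the worst of the
      rest by the trade-off, which needs \<open>j + 1\<close> to be at least 3.\<close>
    let ?T = "max ((d + 5) * diss_max (j + 2)) ((d + 4) * diss_max (j + 1) + diss_max (j + 4))"
    have "(d + 1 + e) * diss_max (j + 4 - e) + b \<le> ?T"
      if "2 \<le> e" "e \<le> j + 4" "b \<le> diss_max (j + 4)" "b \<le> e * diss_max (j + 2)" for e b
    proof (cases "e = 2")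
      case True
      then show ?thesis using that by (simp add: algebra_simps)
    next
      case False
      have "(d + 1 + e) * diss_max (j + 4 - e) \<le> (d + 4) * diss_max (j + 1)"
        using weighted_diss_max_le[of "d + 4" "j + 1" "e - 3"] 3 that False by (simp add: ac_simps)
      then show ?thesis using that by simp
    qed
    moreover have a: "d * ((d + 5) * diss_max (j + 2)) + 2 * diss_max (j + 4) < 2 * diss_max (j + 5 + d)"
      using d
    proof (induction j rule: diss_max_induct)
      case (1 n) then show ?case by (auto dest!: less13_cases)
    next
      case (2 n) then show ?case using diss_max_step[OF 2(1)] by (auto simp: add.assoc)
    qed
    moreover have b: "d * ((d + 4) * diss_max (j + 1) + diss_max (j + 4)) + 2 * diss_max (j + 4) < 2 * diss_max (j + 5 + d)"
      using d 3
    proof (induction j rule: diss_max_induct)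
      case (1 n) then show ?case by (auto dest!: less13_cases)
    next
      case (2 n) then show ?case using diss_max_step[OF 2(1)] by (auto simp: add.assoc)
    qed
    moreover have "d * ?T + 2 * diss_max (j + 4) < 2 * diss_max (j + 5 + d)"
      using a b by (simp add: max_def)
    ultimately show ?thesis by blast
  qed
qed

section \<open>Extremal component sizes\<close>

text \<open>This is \<open>phi\<close> of a K_m^*; the exception at 1 arises because a single vertex
  is itself a maximal set.\<close>

definition Kstar_count :: "nat \<Rightarrow> nat" where
  "Kstar_count m = (if m = 1 then 1 else m choose 2)"

lemma Kstar_count_simps:
  "Kstar_count (Suc 0) = 1" "Kstar_count 2 = 1" "Kstar_count 3 = 3" "Kstar_count 4 = 6"
  "Kstar_count 5 = 10" "Kstar_count 6 = 15" "Kstar_count 7 = 21"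
  by (simp_all add: Kstar_count_def choose_two)

lemma Kstar_count_le: "1 \<le> m \<Longrightarrow> Kstar_count m \<le> diss_max m"
  using sq_le_diss_max[of "m - 1"] by (auto simp: Kstar_count_def choose_two mult.commute)

text \<open>Hence no component of an extremal graph has more than seven vertices.\<close>

lemma Kstar_count_less: "8 \<le> m \<Longrightarrow> Kstar_count m < diss_max m"
proof -
  assume m: "8 \<le> m"
  have "8 \<le> m \<Longrightarrow> m * (m - 1) < 2 * diss_max m" for m
  proof (induction m rule: diss_max_induct)
    case (1 n) then show ?case by (auto dest!: less13_cases)
  next
    case (2 n)
    have "(n + 5) * (n + 5 - 1) \<le> 10 * (n * (n - 1))"
    proof -
      obtain k where "n = k + 8" using 2(1) by (metis add.commute le_iff_add)
      then show ?thesis by (simp add: algebra_simps)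
    qed
    then show ?case using 2 by (simp add: diss_max_add5)
  qed
  from this[OF m] have "m * (m - 1) div 2 < diss_max m"
    by (intro less_mult_imp_div_less) (simp add: mult.commute)
  with m show ?thesis by (simp add: Kstar_count_def choose_two)
qed

lemma prod_Kstar_count_le:
  "(\<And>m. m \<in># S \<Longrightarrow> 1 \<le> m) \<Longrightarrow> prod_mset (image_mset Kstar_count S) \<le> diss_max (sum_mset S)"
proof (induction S)
  case (add m S)
  then have "Kstar_count m * prod_mset (image_mset Kstar_count S) \<le> diss_max m * diss_max (sum_mset S)"
    using Kstar_count_le by (intro mult_le_mono) auto
  then show ?case using diss_max_supermult[of m "sum_mset S"] by simp
qed simp

lemma diss_max_closed:
  "diss_max (5 * t + 8) = 36 * 10 ^ t" "diss_max (5 * t + 9) = 60 * 10 ^ t"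
  "diss_max (5 * t + 10) = 100 * 10 ^ t" "diss_max (5 * t + 11) = 150 * 10 ^ t"
  "diss_max (5 * t + 12) = 225 * 10 ^ t"
proof -
  have "diss_max (5 * t + k) = diss_max k * 10 ^ t" if "8 \<le> k" for k
  proof (induction t)
    case (Suc t)
    have "5 * Suc t + k = 5 * t + k + 5" by simp
    then show ?case using diss_max_add5[of "5 * t + k"] Suc that by (simp only:) simp
  qed simp
  then show "diss_max (5 * t + 8) = 36 * 10 ^ t" "diss_max (5 * t + 9) = 60 * 10 ^ t"
    "diss_max (5 * t + 10) = 100 * 10 ^ t" "diss_max (5 * t + 11) = 150 * 10 ^ t"
    "diss_max (5 * t + 12) = 225 * 10 ^ t" by simp_all
qed

text \<open>Components with 1, 2, 3 or 7 vertices are optimal on their own. They are excluded only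
  because splitting one off from at least 8 vertices loses; the coefficients 1, 1, 3, 21 are their
  values of \<open>Kstar_count\<close>.\<close>

lemma diss_max_gaps:
  assumes "8 \<le> n"
  shows "diss_max (n - 1) < diss_max n" "diss_max (n - 2) < diss_max n" "3 * diss_max (n - 3) < diss_max n"
    "21 * diss_max (n - 7) < diss_max n"
proof -
  obtain k where k: "n = k + 8" using assms by (metis add.commute le_iff_add)
  have "diss_max (k + 7) < diss_max (k + 8) \<and> diss_max (k + 6) < diss_max (k + 8)
      \<and> 3 * diss_max (k + 5) < diss_max (k + 8) \<and> 21 * diss_max (k + 1) < diss_max (k + 8)"
  proof (induction k rule: diss_max_induct)
    case (1 n) then show ?case by (auto dest!: less13_cases)
  next
    case (2 n) then show ?case using diss_max_step[OF 2(1)] by (auto simp: add.assoc)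
  qed
  then show "diss_max (n - 1) < diss_max n" "diss_max (n - 2) < diss_max n" "3 * diss_max (n - 3) < diss_max n"
    "21 * diss_max (n - 7) < diss_max n" by (simp_all add: k add.commute)
qed

section \<open>The multisets of component sizes that attain the maximum\<close>

definition extremal_sizes :: "nat \<Rightarrow> nat \<Rightarrow> nat multiset" where
  "extremal_sizes t r = (if r = 0 then replicate_mset t 5
    else if r = 1 then {#6#} + replicate_mset (t - 1) 5
    else if r = 2 then replicate_mset 2 6 + replicate_mset (t - 2) 5
    else if r = 3 then replicate_mset 2 4 + replicate_mset (t - 1) 5
    else {#4#} + replicate_mset t 5)"

text \<open>With at least 8 vertices, \<open>t\<close> is at least 2 for \<open>r\<close> up to 2
  and at least 1 otherwise, so none of the exponents is truncated.\<close>

lemma diss_max_residue: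
  assumes "8 \<le> 5 * t + r"
  shows "r = 0 \<Longrightarrow> diss_max (5 * t + r) = 10 ^ t"
    "r = 1 \<Longrightarrow> diss_max (5 * t + r) = 15 * 10 ^ (t - 1)"
    "r = 2 \<Longrightarrow> diss_max (5 * t + r) = 225 * 10 ^ (t - 2)"
    "r = 3 \<Longrightarrow> diss_max (5 * t + r) = 36 * 10 ^ (t - 1)"
    "r = 4 \<Longrightarrow> diss_max (5 * t + r) = 6 * 10 ^ t"
proof -
  { assume "r = 0 \<or> r = 1 \<or> r = 2"
    with assms have "2 \<le> t" by auto
    then obtain k where "t = k + 2" by (metis add.commute le_iff_add)
    then have "r = 0 \<Longrightarrow> diss_max (5 * t + r) = 10 ^ t"
      "r = 1 \<Longrightarrow> diss_max (5 * t + r) = 15 * 10 ^ (t - 1)"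
      "r = 2 \<Longrightarrow> diss_max (5 * t + r) = 225 * 10 ^ (t - 2)"
      using diss_max_closed[of k] by (simp_all add: algebra_simps numeral_eq_Suc) }
  moreover { assume "r = 3 \<or> r = 4"
    with assms have "1 \<le> t" by auto
    then obtain k where "t = k + 1" by (metis add.commute le_iff_add)
    then have "r = 3 \<Longrightarrow> diss_max (5 * t + r) = 36 * 10 ^ (t - 1)"
      "r = 4 \<Longrightarrow> diss_max (5 * t + r) = 6 * 10 ^ t"
      using diss_max_closed[of k] by (simp_all add: algebra_simps) }
  ultimately show "r = 0 \<Longrightarrow> diss_max (5 * t + r) = 10 ^ t"
    "r = 1 \<Longrightarrow> diss_max (5 * t + r) = 15 * 10 ^ (t - 1)"
    "r = 2 \<Longrightarrow> diss_max (5 * t + r) = 225 * 10 ^ (t - 2)"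
    "r = 3 \<Longrightarrow> diss_max (5 * t + r) = 36 * 10 ^ (t - 1)"
    "r = 4 \<Longrightarrow> diss_max (5 * t + r) = 6 * 10 ^ t" by blast+
qed

lemma extremal_sizes_iff:
  assumes pos: "\<And>m. m \<in># S \<Longrightarrow> 1 \<le> m" and sum: "sum_mset S = 5 * t + r" and n8: "8 \<le> 5 * t + r" and r: "r < 5"
  shows "prod_mset (image_mset Kstar_count S) = diss_max (5 * t + r) \<longleftrightarrow> S = extremal_sizes t r"
proof
  assume "S = extremal_sizes t r"
  moreover have "r = 0 \<or> r = 1 \<or> r = 2 \<or> r = 3 \<or> r = 4" using r by linarith
  ultimately show "prod_mset (image_mset Kstar_count S) = diss_max (5 * t + r)"
    using diss_max_residue[OF n8]
    by (auto simp: extremal_sizes_def Kstar_count_simps numeral_2_eq_2 image_replicate_mset)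
next
  let ?n = "5 * t + r"
  assume prod: "prod_mset (image_mset Kstar_count S) = diss_max ?n"
  have sub: "sum_mset T \<le> ?n \<and> diss_max ?n \<le> prod_mset (image_mset Kstar_count T) * diss_max (?n - sum_mset T)"
    if "T \<subseteq># S" for T
  proof -
    obtain R where R: "S = T + R" using \<open>T \<subseteq># S\<close> by (metis subset_mset.le_iff_add)
    then have "sum_mset R = ?n - sum_mset T" "sum_mset T \<le> ?n" using sum by simp_all
    moreover have "prod_mset (image_mset Kstar_count R) \<le> diss_max (sum_mset R)"
      by (rule prod_Kstar_count_le) (use pos R in auto)
    moreover have "diss_max ?n = prod_mset (image_mset Kstar_count T) * prod_mset (image_mset Kstar_count R)"
      using prod R by simp
    ultimately show ?thesis using mult_le_mono2 by metis
  qed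
  \<comment> \<open>An exchange argument: a part of an optimal multiset is optimal for its own sum,
    since replacing it would otherwise exceed the maximum.\<close>
  have tight: "diss_max (sum_mset T) \<le> prod_mset (image_mset Kstar_count T)" if "T \<subseteq># S" for T
  proof (rule ccontr)
    assume "\<not> ?thesis"
    then have "prod_mset (image_mset Kstar_count T) * diss_max (?n - sum_mset T)
        < diss_max (sum_mset T) * diss_max (?n - sum_mset T)"
      using diss_max_pos by simp
    also have "\<dots> \<le> diss_max ?n"
      using diss_max_supermult[of "sum_mset T" "?n - sum_mset T"] sub[OF that] by simp
    finally show False using sub[OF that] by linarith
  qed
  have mem: "m = 4 \<or> m = 5 \<or> m = 6" if "m \<in># S" for m
  proof -
    have le: "diss_max ?n \<le> Kstar_count m * diss_max (?n - m)" "diss_max m \<le> Kstar_count m"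
      using sub[of "{#m#}"] tight[of "{#m#}"] that by auto
    have "m < 8" using le(2) Kstar_count_less[of m] by linarith
    moreover have "m \<noteq> 1" "m \<noteq> 2" "m \<noteq> 3" "m \<noteq> 7"
      using le(1) diss_max_gaps[OF n8] by (auto simp: Kstar_count_simps)
    moreover have "1 \<le> m" using pos that .
    ultimately show ?thesis by linarith
  qed
  define a b c where "a = count S 4" and "b = count S 5" and "c = count S 6"
  have S: "S = replicate_mset a 4 + replicate_mset b 5 + replicate_mset c 6"
  proof (rule multiset_eqI)
    fix x show "count S x = count (replicate_mset a 4 + replicate_mset b 5 + replicate_mset c 6) x"
      using mem[of x] by (cases "x \<in># S") (auto simp: a_def b_def c_def not_in_iff)
  qed
  have sub': "replicate_mset i x \<subseteq># S" if "i \<le> count S x" for i x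
    using that by (simp add: count_le_replicate_mset_subset_eq)
  \<comment> \<open>Three 4s give 216 < 225, three 6s give 3375 < 3600, and a 4 with a 6 gives 90 <
    100.\<close>
  have "a < 3"
    using tight[OF sub'[of 3 4]] by (fastforce simp: a_def Kstar_count_simps numeral_3_eq_3)
  moreover have "c < 3"
    using tight[OF sub'[of 3 6]] by (fastforce simp: c_def Kstar_count_simps numeral_3_eq_3)
  moreover have "\<not> (0 < a \<and> 0 < c)"
  proof
    assume "0 < a \<and> 0 < c"
    then have "{#4, 6#} \<subseteq># S" by (auto simp: a_def c_def insert_subset_eq_iff in_diff_count)
    from tight[OF this] show False by (simp add: Kstar_count_simps)
  qed
  ultimately have "a = 0 \<and> c = 0 \<or> a = 1 \<and> c = 0 \<or> a = 2 \<and> c = 0 \<or> a = 0 \<and> c = 1 \<or> a = 0 \<and> c = 2"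
    by linarith
  \<comment> \<open>Modulo 5 this says that \<open>c - a\<close> is congruent to \<open>r\<close>,
    and the five surviving pairs realise five different residues.\<close>
  moreover have "4 * a + 5 * b + 6 * c = 5 * t + r" using sum by (simp add: S)
  ultimately have "a = 0 \<and> c = 0 \<and> r = 0 \<and> b = t \<or> a = 1 \<and> c = 0 \<and> r = 4 \<and> b = t
    \<or> a = 2 \<and> c = 0 \<and> r = 3 \<and> b = t - 1 \<or> a = 0 \<and> c = 1 \<and> r = 1 \<and> b = t - 1
    \<or> a = 0 \<and> c = 2 \<and> r = 2 \<and> b = t - 2"
    using r by presburger
  then show "S = extremal_sizes t r"
    by (elim disjE) (simp_all add: S extremal_sizes_def)
qed

section \<open>Maximal dissociation sets\<close>

text \<open>No vertex set is fixed: \<open>phi A adj\<close> sees only the edges inside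
  \<open>A\<close>, so the induced subgraphs needed for the induction are plain subsets with the
  same relation.\<close>

locale sgraph =
  fixes adj :: "'a \<Rightarrow> 'a \<Rightarrow> bool"
  assumes sym: "adj x y \<Longrightarrow> adj y x" and irrefl: "\<not> adj x x"
begin

definition nb :: "'a set \<Rightarrow> 'a \<Rightarrow> 'a set" where
  "nb A v = {u \<in> A. adj v u}"

definition MDS :: "'a set \<Rightarrow> 'a set set" where
  "MDS A = {F. maximal_dissociation_set A adj F}"

definition diss :: "'a set \<Rightarrow> bool" where
  "diss F \<longleftrightarrow> (\<forall>x\<in>F. \<forall>y\<in>F. \<forall>z\<in>F. adj x y \<longrightarrow> adj x z \<longrightarrow> y = z)"

definition paired :: "'a set \<Rightarrow> 'a \<Rightarrow> bool" where
  "paired F v \<longleftrightarrow> v \<in> F \<and> (\<exists>u\<in>F. adj v u)"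

lemma phi_eq: "phi A adj = card (MDS A)"
  by (simp add: phi_def MDS_def)

lemma diss_mono: "diss F \<Longrightarrow> F' \<subseteq> F \<Longrightarrow> diss F'"
  unfolding diss_def by blast

lemma dissociation_set_iff:
  assumes "finite A"
  shows "dissociation_set A adj F \<longleftrightarrow> F \<subseteq> A \<and> diss F"
proof -
  have "card {y \<in> F. adj x y} \<le> 1 \<longleftrightarrow> (\<forall>y\<in>F. \<forall>z\<in>F. adj x y \<longrightarrow> adj x z \<longrightarrow> y = z)" if "F \<subseteq> A" for x
    using finite_subset[OF that assms] by (subst One_nat_def, subst card_le_Suc0_iff_eq) auto
  then show ?thesis unfolding dissociation_set_def diss_def by blast
qed

text \<open>Dissociation sets are closed under subsets, so maximality need only be tested against
  one additional vertex.\<close>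

lemma MDS_iff:
  assumes "finite A"
  shows "F \<in> MDS A \<longleftrightarrow> F \<subseteq> A \<and> diss F \<and> (\<forall>x\<in>A - F. \<not> diss (insert x F))"
proof
  assume "F \<in> MDS A"
  then show "F \<subseteq> A \<and> diss F \<and> (\<forall>x\<in>A - F. \<not> diss (insert x F))"
    unfolding MDS_def maximal_dissociation_set_def dissociation_set_iff[OF assms] by blast
next
  assume *: "F \<subseteq> A \<and> diss F \<and> (\<forall>x\<in>A - F. \<not> diss (insert x F))"
  have "\<not> (F' \<subseteq> A \<and> diss F' \<and> F \<subset> F')" for F'
  proof
    assume F': "F' \<subseteq> A \<and> diss F' \<and> F \<subset> F'"
    then obtain x where "x \<in> F'" "x \<notin> F" by blast
    then show False using * F' diss_mono[of F' "insert x F"] by blast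
  qed
  then show "F \<in> MDS A"
    unfolding MDS_def maximal_dissociation_set_def dissociation_set_iff[OF assms] using * by blast
qed

lemma MDS_subset: "F \<in> MDS A \<Longrightarrow> F \<subseteq> A"
  by (simp add: MDS_def maximal_dissociation_set_def dissociation_set_def)

lemma finite_MDS: "finite A \<Longrightarrow> finite (MDS A)"
  by (rule finite_subset[of _ "Pow A"]) (auto dest: MDS_subset)

lemma MDS_empty: "MDS {} = {{}}"
  by (auto simp: MDS_iff diss_def)

text \<open>Adding \<open>x\<close> can violate the degree condition only at a neighbour that
  already has a partner or at \<open>x\<close> itself.\<close>

lemma MDS_blocked:
  assumes "finite A" "F \<in> MDS A" "x \<in> A - F"
  shows "(\<exists>u\<in>F. adj x u \<and> paired F u) \<or> (\<exists>u\<in>F. \<exists>w\<in>F. u \<noteq> w \<and> adj x u \<and> adj x w)"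
proof (rule ccontr)
  assume contr: "\<not> ?thesis"
  have *: "\<not> paired F u" if "u \<in> F" "adj x u" for u
    using that contr by blast
  have **: "u = w" if "u \<in> F" "w \<in> F" "adj x u" "adj x w" for u w
    using that contr by blast
  have "diss F" and "\<not> diss (insert x F)" using assms by (auto simp: MDS_iff)
  moreover have "diss (insert x F)"
    unfolding diss_def
  proof (intro ballI impI)
    fix a b c assume abc: "a \<in> insert x F" "b \<in> insert x F" "c \<in> insert x F" "adj a b" "adj a c"
    show "b = c"
    proof (cases "a = x")
      case True
      then show ?thesis using abc ** irrefl by blast
    next
      case False
      then show ?thesis using abc * sym \<open>diss F\<close> unfolding diss_def paired_def by blast
    qed
  qed
  ultimately show False by blast
qed

text \<open>No edge within \<open>insert x F\<close> crosses the border of \<open>R\<close> when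
  \<open>x\<close> lies in \<open>A - R\<close>. So a vertex that could be added to
  \<open>F - R\<close> could also be added to \<open>F\<close>.\<close>

lemma MDS_restrict:
  assumes "finite A" "F \<in> MDS A" and "\<And>s y. s \<in> F \<inter> R \<Longrightarrow> y \<in> A - R \<Longrightarrow> \<not> adj s y"
  shows "F - R \<in> MDS (A - R)"
proof -
  have F: "F \<subseteq> A" "diss F" "\<And>x. x \<in> A - F \<Longrightarrow> \<not> diss (insert x F)"
    using assms by (auto simp: MDS_iff)
  have "\<not> diss (insert x (F - R))" if x: "x \<in> A - R - (F - R)" for x
  proof
    assume d: "diss (insert x (F - R))"
    have "diss (insert x F)"
      unfolding diss_def
    proof (intro ballI impI)
      fix a b c assume abc: "a \<in> insert x F" "b \<in> insert x F" "c \<in> insert x F" "adj a b" "adj a c"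
      have sep: "p \<in> R \<longleftrightarrow> q \<in> R" if "p \<in> insert x F" "q \<in> insert x F" "adj p q" for p q
        using that assms(3) x F(1) sym by blast
      show "b = c"
      proof (cases "a \<in> R")
        case True
        then have "a \<in> F" "b \<in> F" "c \<in> F" using abc sep x by auto
        then show ?thesis using F(2) abc unfolding diss_def by blast
      next
        case False
        then have "a \<in> insert x (F - R)" "b \<in> insert x (F - R)" "c \<in> insert x (F - R)"
          using abc sep by auto
        then show ?thesis using d abc unfolding diss_def by blast
      qed
    qed
    then show False using F(3)[of x] x by blast
  qed
  then show ?thesis
    using F assms(1) by (auto simp: MDS_iff intro: diss_mono)
qed

text \<open>The sets in \<open>X\<close> share the trace \<open>S\<close> on \<open>R\<close>, so
  each is determined by \<open>F - R\<close>. The predicate \<open>P\<close> carries over what is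
  known about this remainder.\<close>

lemma card_MDS_restrict:
  assumes "finite A" and sep: "\<And>s y. s \<in> S \<Longrightarrow> y \<in> A - R \<Longrightarrow> \<not> adj s y"
    and X: "\<And>F. F \<in> X \<Longrightarrow> F \<in> MDS A \<and> F \<inter> R = S \<and> P (F - R)"
  shows "card X \<le> card {F \<in> MDS (A - R). P F}"
proof (rule card_inj_on_le)
  show "inj_on (\<lambda>F. F - R) X"
  proof (rule inj_onI)
    fix F G assume "F \<in> X" "G \<in> X" "F - R = G - R"
    moreover have "F = (F - R) \<union> (F \<inter> R)" "G = (G - R) \<union> (G \<inter> R)" by blast+
    ultimately show "F = G" using X by metis
  qed
  show "(\<lambda>F. F - R) ` X \<subseteq> {F \<in> MDS (A - R). P F}"
  proof (rule image_subsetI)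
    fix F assume "F \<in> X"
    with X have F: "F \<in> MDS A" "F \<inter> R = S" "P (F - R)" by auto
    then have "F - R \<in> MDS (A - R)" by (intro MDS_restrict assms(1) sep) auto
    with F show "F - R \<in> {F \<in> MDS (A - R). P F}" by simp
  qed
  show "finite {F \<in> MDS (A - R). P F}" using assms(1) by (simp add: finite_MDS)
qed

lemma card_MDS_restrict_phi:
  assumes "finite A" and "\<And>s y. s \<in> S \<Longrightarrow> y \<in> A - R \<Longrightarrow> \<not> adj s y"
    and "\<And>F. F \<in> X \<Longrightarrow> F \<in> MDS A \<and> F \<inter> R = S"
  shows "card X \<le> phi (A - R) adj"
  using card_MDS_restrict[of A S R X "\<lambda>_. True"] assms by (simp add: phi_eq)

section \<open>Disjoint unions\<close>

lemma MDS_Un_bij: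
  assumes fin: "finite B" "finite C" and disj: "B \<inter> C = {}"
    and sep: "\<And>x y. x \<in> B \<Longrightarrow> y \<in> C \<Longrightarrow> \<not> adj x y"
  shows "bij_betw (\<lambda>(F, G). F \<union> G) (MDS B \<times> MDS C) (MDS (B \<union> C))"
proof -
  have diss_Un: "diss (F \<union> G) \<longleftrightarrow> diss F \<and> diss G" if "F \<subseteq> B" "G \<subseteq> C" for F G
  proof
    assume "diss F \<and> diss G"
    then have FG: "diss F" "diss G" by auto
    have same: "a \<in> F \<longleftrightarrow> b \<in> F" "a \<in> G \<longleftrightarrow> b \<in> G" if "a \<in> F \<union> G" "b \<in> F \<union> G" "adj a b" for a b
      using that \<open>F \<subseteq> B\<close> \<open>G \<subseteq> C\<close> sep[of a b] sep[of b a] sym[of a b] disj by blast+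
    show "diss (F \<union> G)"
      unfolding diss_def
    proof (intro ballI impI)
      fix a b c assume abc: "a \<in> F \<union> G" "b \<in> F \<union> G" "c \<in> F \<union> G" "adj a b" "adj a c"
      show "b = c"
      proof (cases "a \<in> F")
        case True
        then have "b \<in> F" "c \<in> F" using same[of a b] same[of a c] abc by blast+
        then show ?thesis using FG(1) True abc unfolding diss_def by blast
      next
        case False
        then have "a \<in> G" "b \<in> G" "c \<in> G" using same[of a b] same[of a c] abc False by blast+
        then show ?thesis using FG(2) abc unfolding diss_def by blast
      qed
    qed
  next
    assume "diss (F \<union> G)"
    then show "diss F \<and> diss G" using diss_mono[of "F \<union> G" F] diss_mono[of "F \<union> G" G] by simp
  qed
  have MDS_Un: "F \<union> G \<in> MDS (B \<union> C) \<longleftrightarrow> F \<in> MDS B \<and> G \<in> MDS C" if "F \<subseteq> B" "G \<subseteq> C" for F G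
  proof -
    have 1: "diss (insert x (F \<union> G)) \<longleftrightarrow> diss (insert x F) \<and> diss G" if "x \<in> B" for x
      using diss_Un[of "insert x F" G] \<open>F \<subseteq> B\<close> \<open>G \<subseteq> C\<close> that by simp
    have 2: "diss (insert x (F \<union> G)) \<longleftrightarrow> diss F \<and> diss (insert x G)" if "x \<in> C" for x
      using diss_Un[of F "insert x G"] \<open>F \<subseteq> B\<close> \<open>G \<subseteq> C\<close> that by simp
    have eq: "(\<forall>x\<in>B \<union> C - (F \<union> G). \<not> diss (insert x (F \<union> G))) \<longleftrightarrow>
        (\<forall>x\<in>B - F. \<not> (diss (insert x F) \<and> diss G)) \<and> (\<forall>x\<in>C - G. \<not> (diss F \<and> diss (insert x G)))"
    proof -
      have "B \<union> C - (F \<union> G) = (B - F) \<union> (C - G)" using that disj by blast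
      then show ?thesis by (simp add: ball_Un 1 2)
    qed
    show ?thesis
      unfolding MDS_iff[OF fin(1)] MDS_iff[OF fin(2)] MDS_iff[OF finite_UnI[OF fin]] eq diss_Un[OF that]
      using that by (cases "diss F"; cases "diss G"; simp; blast)
  qed
  show ?thesis
  proof (rule bij_betwI')
    fix p q assume "p \<in> MDS B \<times> MDS C" "q \<in> MDS B \<times> MDS C"
    moreover obtain F G F' G' where pq: "p = (F, G)" "q = (F', G')" by (cases p, cases q)
    ultimately have sub: "F \<subseteq> B" "F' \<subseteq> B" "G \<subseteq> C" "G' \<subseteq> C" by (auto dest: MDS_subset)
    then have "F = (F \<union> G) \<inter> B" "G = (F \<union> G) \<inter> C" "F' = (F' \<union> G') \<inter> B" "G' = (F' \<union> G') \<inter> C"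
      using disj by blast+
    then have "F \<union> G = F' \<union> G' \<longleftrightarrow> F = F' \<and> G = G'" by metis
    then show "((case p of (F, G) \<Rightarrow> F \<union> G) = (case q of (F, G) \<Rightarrow> F \<union> G)) = (p = q)"
      using pq by simp
  next
    fix p assume "p \<in> MDS B \<times> MDS C"
    then show "(case p of (F, G) \<Rightarrow> F \<union> G) \<in> MDS (B \<union> C)"
      using MDS_Un by (auto dest: MDS_subset)
  next
    fix E assume E: "E \<in> MDS (B \<union> C)"
    then have eq: "(E \<inter> B) \<union> (E \<inter> C) = E" using MDS_subset[OF E] by blast
    have "(E \<inter> B, E \<inter> C) \<in> MDS B \<times> MDS C"
      using MDS_Un[of "E \<inter> B" "E \<inter> C", unfolded eq] E by simp
    then show "\<exists>p\<in>MDS B \<times> MDS C. E = (case p of (F, G) \<Rightarrow> F \<union> G)"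
      using eq by (intro bexI[of _ "(E \<inter> B, E \<inter> C)"]) auto
  qed
qed

lemma phi_Un:
  assumes "finite B" "finite C" "B \<inter> C = {}" "\<And>x y. x \<in> B \<Longrightarrow> y \<in> C \<Longrightarrow> \<not> adj x y"
  shows "phi (B \<union> C) adj = phi B adj * phi C adj"
  using bij_betw_same_card[OF MDS_Un_bij[OF assms]] by (simp add: phi_eq card_cartesian_product)

text \<open>Every vertex receives weight at least 2: from both ends of an edge of G[F] dominating it, or
  from itself if it is isolated in G[F], or else from two isolated vertices of G[F].\<close>
definition weight :: "'a set \<Rightarrow> 'a \<Rightarrow> 'a \<Rightarrow> nat" where
  "weight F v x = (if paired F v then of_bool (\<exists>u\<in>F. adj v u \<and> (adj v x \<or> adj u x))
     else if x = v then 2 else of_bool (adj v x \<and> (\<forall>u\<in>F. adj x u \<longrightarrow> \<not> paired F u)))"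

lemma two_le_sum:
  fixes g :: "'a \<Rightarrow> nat"
  assumes "finite F" "a \<in> F" "b \<in> F" "a \<noteq> b" "g a = 1" "g b = 1"
  shows "2 \<le> sum g F"
proof -
  have "sum g {a, b} \<le> sum g F" using assms by (intro sum_mono2) auto
  then show ?thesis using assms by simp
qed

lemma sum_weight_ge:
  assumes "finite A" "F \<in> MDS A" "x \<in> A"
  shows "2 \<le> (\<Sum>v\<in>F. weight F v x)"
proof -
  have fin: "finite F" using assms MDS_subset finite_subset by blast
  show ?thesis
  proof (cases "\<exists>p\<in>F. paired F p \<and> adj p x")
    case True
    then obtain p q where pq: "p \<in> F" "q \<in> F" "adj p q" "adj p x" by (auto simp: paired_def)
    have "adj q p" using pq(3) by (rule sym)
    have "p \<noteq> q" using pq(3) irrefl by metis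
    have "paired F p" "paired F q" using pq \<open>adj q p\<close> by (auto simp: paired_def)
    moreover have "\<exists>u\<in>F. adj p u \<and> (adj p x \<or> adj u x)" "\<exists>u\<in>F. adj q u \<and> (adj q x \<or> adj u x)"
      using pq \<open>adj q p\<close> by blast+
    ultimately have "weight F p x = 1" "weight F q x = 1" by (simp_all add: weight_def)
    then show ?thesis by (rule two_le_sum[OF fin pq(1,2) \<open>p \<noteq> q\<close>, of "\<lambda>v. weight F v x"])
  next
    case False
    then have no: "\<not> paired F u" if "u \<in> F" "adj x u" for u
      using that False sym[of x u] by blast
    show ?thesis
    proof (cases "x \<in> F")
      case True
      have "\<not> paired F x" using no True sym[of x] unfolding paired_def by metis
      then have "weight F x x = 2" by (simp add: weight_def)
      then show ?thesis using member_le_sum[of x F "\<lambda>v. weight F v x"] True fin by simp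
    next
      case False
      then obtain u w where uw: "u \<in> F" "w \<in> F" "u \<noteq> w" "adj x u" "adj x w"
        using MDS_blocked[of A F x] assms no by blast
      have "adj u x" "adj w x" using sym[OF uw(4)] sym[OF uw(5)] by simp_all
      then have "weight F u x = 1" "weight F w x = 1"
        using uw no False by (auto simp: weight_def)
      then show ?thesis by (rule two_le_sum[OF fin uw(1-3), of "\<lambda>v. weight F v x"])
    qed
  qed
qed

section \<open>Double counting of the weights\<close>

definition load :: "'a set \<Rightarrow> 'a \<Rightarrow> nat" where
  "load A v = (\<Sum>F | F \<in> MDS A \<and> v \<in> F. \<Sum>x\<in>A. weight F v x)"

lemma phi_le_sum_load:
  assumes "finite A"
  shows "2 * card A * phi A adj \<le> (\<Sum>v\<in>A. load A v)"
proof -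
  have "2 * card A * phi A adj = (\<Sum>F\<in>MDS A. \<Sum>x\<in>A. 2)" by (simp add: phi_eq)
  also have "\<dots> \<le> (\<Sum>F\<in>MDS A. \<Sum>x\<in>A. \<Sum>v\<in>F. weight F v x)"
    by (intro sum_mono sum_weight_ge[OF assms])
  also have "\<dots> = (\<Sum>F\<in>MDS A. \<Sum>v | v \<in> A \<and> v \<in> F. \<Sum>x\<in>A. weight F v x)"
  proof (rule sum.cong)
    fix F assume "F \<in> MDS A"
    then have eq: "{v. v \<in> A \<and> v \<in> F} = F" using MDS_subset by blast
    show "(\<Sum>x\<in>A. \<Sum>v\<in>F. weight F v x) = (\<Sum>v | v \<in> A \<and> v \<in> F. \<Sum>x\<in>A. weight F v x)"
      unfolding eq by (rule sum.swap)
  qed simp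
  also have "\<dots> = (\<Sum>v\<in>A. \<Sum>F | F \<in> MDS A \<and> v \<in> F. \<Sum>x\<in>A. weight F v x)"
    using assms by (intro sum.swap_restrict finite_MDS)
  finally show ?thesis by (simp add: load_def)
qed

definition iso_MDS :: "'a set \<Rightarrow> 'a \<Rightarrow> 'a set set" where
  "iso_MDS A v = {F \<in> MDS A. v \<in> F \<and> \<not> paired F v}"

text \<open>The condition in the last clause of \<open>weight\<close>: it decides whether
  \<open>u\<close> receives 1 from an isolated neighbour.\<close>

definition unpaired_at :: "'a set \<Rightarrow> 'a \<Rightarrow> bool" where
  "unpaired_at F u \<longleftrightarrow> (\<forall>p\<in>F. adj u p \<longrightarrow> \<not> paired F p)"

text \<open>In a given \<open>F\<close> either \<open>v\<close> has a unique partner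
  \<open>u\<close> and sends 1 to each vertex of N(v) and N(u), or it sends 2 to itself and 1 to
  every neighbour satisfying \<open>unpaired_at\<close>. Exchanging the sums over \<open>F\<close>
  and \<open>u\<close> leaves cardinalities of families of sets.\<close>

lemma load_le:
  assumes fin: "finite A" and v: "v \<in> A"
  shows "load A v \<le> (\<Sum>u\<in>nb A v. card (nb A v \<union> nb A u) * card {F \<in> MDS A. u \<in> F \<and> v \<in> F}
      + card {F \<in> iso_MDS A v. unpaired_at F u}) + 2 * card (iso_MDS A v)"
proof -
  have finMD: "finite (MDS A)" using fin by (rule finite_MDS)
  have finnb: "finite (nb A v)" using fin by (simp add: nb_def)
  let ?X = "{F \<in> MDS A. v \<in> F}"
  have *: "(\<Sum>x\<in>A. weight F v x) \<le> (\<Sum>u\<in>nb A v. of_bool (u \<in> F) * card (nb A v \<union> nb A u)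
      + of_bool (F \<in> iso_MDS A v \<and> unpaired_at F u)) + 2 * of_bool (F \<in> iso_MDS A v)" if F: "F \<in> ?X" for F
  proof (cases "paired F v")
    case True
    then obtain u where u: "u \<in> F" "adj v u" by (auto simp: paired_def)
    have F': "diss F" "F \<subseteq> A" using F fin by (auto simp: MDS_iff)
    have "weight F v x \<le> of_bool (x \<in> nb A v \<union> nb A u)" if "x \<in> A" for x
      using True u F F' that unfolding weight_def nb_def diss_def by (auto split: if_splits)
    then have "(\<Sum>x\<in>A. weight F v x) \<le> (\<Sum>x\<in>A. of_bool (x \<in> nb A v \<union> nb A u))" by (rule sum_mono)
    also have "\<dots> = card (nb A v \<union> nb A u)"
    proof -
      have "A \<inter> (nb A v \<union> nb A u) = nb A v \<union> nb A u" by (auto simp: nb_def)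
      then show ?thesis using fin by (simp only: sum_of_bool_eq Collect_mem_eq of_nat_id)
    qed
    also have "\<dots> \<le> (\<Sum>u\<in>nb A v. of_bool (u \<in> F) * card (nb A v \<union> nb A u)
        + of_bool (F \<in> iso_MDS A v \<and> unpaired_at F u))"
      using u F' finnb by (intro order.trans[OF _ member_le_sum[of u]]) (auto simp: nb_def)
    finally show ?thesis by simp
  next
    case False
    then have iso: "F \<in> iso_MDS A v" using F by (simp add: iso_MDS_def)
    have "weight F v x \<le> 2 * of_bool (x = v) + of_bool (x \<in> nb A v \<and> unpaired_at F x)" if "x \<in> A" for x
      using False that by (auto simp: weight_def nb_def unpaired_at_def)
    then have "(\<Sum>x\<in>A. weight F v x) \<le> (\<Sum>x\<in>A. 2 * of_bool (x = v) + of_bool (x \<in> nb A v \<and> unpaired_at F x))"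
      by (rule sum_mono)
    also have "\<dots> = 2 + (\<Sum>x\<in>A. of_bool (x \<in> nb A v \<and> unpaired_at F x))"
      using fin v by (simp add: sum.distrib sum_distrib_left[symmetric] of_bool_def sum.delta)
    also have "(\<Sum>x\<in>A. of_bool (x \<in> nb A v \<and> unpaired_at F x)) = (\<Sum>x\<in>nb A v. of_bool (unpaired_at F x) :: nat)"
      using fin by (intro sum.mono_neutral_cong_right) (auto simp: nb_def)
    also have "2 + \<dots> \<le> (\<Sum>u\<in>nb A v. of_bool (u \<in> F) * card (nb A v \<union> nb A u)
      + of_bool (F \<in> iso_MDS A v \<and> unpaired_at F u)) + 2 * of_bool (F \<in> iso_MDS A v)"
      using iso by (simp add: sum.distrib)
    finally show ?thesis .
  qed
  have "load A v = (\<Sum>F\<in>?X. \<Sum>x\<in>A. weight F v x)" by (simp add: load_def)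
  also have "\<dots> \<le> (\<Sum>F\<in>?X. (\<Sum>u\<in>nb A v. of_bool (u \<in> F) * card (nb A v \<union> nb A u)
      + of_bool (F \<in> iso_MDS A v \<and> unpaired_at F u)) + 2 * of_bool (F \<in> iso_MDS A v))"
    using * by (rule sum_mono)
  also have "\<dots> = (\<Sum>u\<in>nb A v. (\<Sum>F\<in>?X. of_bool (u \<in> F) * card (nb A v \<union> nb A u))
      + (\<Sum>F\<in>?X. of_bool (F \<in> iso_MDS A v \<and> unpaired_at F u))) + 2 * (\<Sum>F\<in>?X. of_bool (F \<in> iso_MDS A v))"
    by (simp only: sum.distrib sum_distrib_left[symmetric] sum.swap[of _ "nb A v"])
  also have "\<dots> = (\<Sum>u\<in>nb A v. card (nb A v \<union> nb A u) * card {F \<in> MDS A. u \<in> F \<and> v \<in> F}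
      + card {F \<in> iso_MDS A v. unpaired_at F u}) + 2 * card (iso_MDS A v)"
  proof -
    have 1: "(\<Sum>F\<in>?X. of_bool (u \<in> F) * c) = c * card {F \<in> MDS A. u \<in> F \<and> v \<in> F}" for u and c :: nat
    proof -
      have "?X \<inter> {F. u \<in> F} = {F \<in> MDS A. u \<in> F \<and> v \<in> F}" by auto
      then show ?thesis using finMD by (simp add: sum_distrib_right[symmetric])
    qed
    have 2: "(\<Sum>F\<in>?X. of_bool (F \<in> iso_MDS A v \<and> unpaired_at F u)) = card {F \<in> iso_MDS A v. unpaired_at F u}" for u
    proof -
      have "?X \<inter> {F. F \<in> iso_MDS A v \<and> unpaired_at F u} = {F \<in> iso_MDS A v. unpaired_at F u}"
        by (auto simp: iso_MDS_def)
      then show ?thesis using finMD by simp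
    qed
    have 3: "(\<Sum>F\<in>?X. of_bool (F \<in> iso_MDS A v)) = card (iso_MDS A v)"
    proof -
      have "?X \<inter> {F. F \<in> iso_MDS A v} = iso_MDS A v" by (auto simp: iso_MDS_def)
      then show ?thesis using finMD by simp
    qed
    show ?thesis by (simp only: 1 2 3)
  qed
  finally show ?thesis .
qed

section \<open>The weight sent out by a vertex\<close>

definition far :: "'a set \<Rightarrow> 'a \<Rightarrow> 'a set" where
  "far A v = A - insert v (nb A v)"

text \<open>The induction hypothesis of \<open>phi_le_diss_max\<close>, in a form that passes to
  every subset of \<open>A\<close>.\<close>

definition bounded_below :: "'a set \<Rightarrow> bool" where
  "bounded_below A \<longleftrightarrow> finite A \<and> (\<forall>B. B \<subset> A \<longrightarrow> phi B adj \<le> diss_max (card B))"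

lemma bounded_below_subset: "bounded_below A \<Longrightarrow> B \<subseteq> A \<Longrightarrow> bounded_below B"
  unfolding bounded_below_def using finite_subset by blast

lemma bounded_belowD: "bounded_below A \<Longrightarrow> B \<subset> A \<Longrightarrow> phi B adj \<le> diss_max (card B)"
  by (simp add: bounded_below_def)

lemma finite_nb: "finite A \<Longrightarrow> finite (nb A v)"
  by (simp add: nb_def)

lemma nb_subset: "nb A v \<subseteq> A"
  by (auto simp: nb_def)

lemma finite_far: "finite A \<Longrightarrow> finite (far A v)"
  by (simp add: far_def)

lemma not_in_nb: "v \<notin> nb A v"
  using irrefl by (simp add: nb_def)

lemma card_eq_far:
  assumes "finite A" "v \<in> A"
  shows "card A = card (nb A v) + 1 + card (far A v)"
proof -
  have "card A = card (insert v (nb A v)) + card (far A v)"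
    using assms nb_subset unfolding far_def
    by (subst card_Diff_subset) (auto simp: finite_nb card_mono intro!: le_add_diff_inverse[symmetric])
  then show ?thesis using assms by (simp add: finite_nb not_in_nb)
qed

lemma nb_Un_eq: "u \<in> nb A v \<Longrightarrow> v \<in> A \<Longrightarrow> nb A v \<union> nb A u = insert v (nb A v) \<union> nb (far A v) u"
  using sym[of v u] by (auto simp: nb_def far_def)

lemma card_nb_Un:
  assumes "finite A" "v \<in> A" "u \<in> nb A v"
  shows "card (nb A v \<union> nb A u) = card (nb A v) + 1 + card (nb (far A v) u)"
proof -
  have "insert v (nb A v) \<inter> nb (far A v) u = {}" by (auto simp: nb_def far_def)
  then show ?thesis
    using assms by (subst nb_Un_eq) (simp_all add: card_Un_disjoint finite_nb finite_far not_in_nb del: Un_insert_left)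
qed

lemma card_Diff_nb_Un:
  assumes "finite A" "v \<in> A" "u \<in> nb A v"
  shows "card (A - (nb A v \<union> nb A u)) = card (far A v) - card (nb (far A v) u)"
proof -
  have "A - (nb A v \<union> nb A u) = far A v - nb (far A v) u"
    using nb_Un_eq[OF assms(3,2)] by (auto simp: far_def)
  then show ?thesis using assms by (simp add: card_Diff_subset finite_nb finite_far nb_subset)
qed

text \<open>With \<open>u\<close> and \<open>v\<close> as partners, \<open>F\<close> contains no
  other vertex of N(v) or N(u), so its remainder is a maximal set of the graph that this edge does
  not dominate.\<close>

lemma pair_count:
  assumes "bounded_below A" "v \<in> A" "u \<in> nb A v"
  shows "card {F \<in> MDS A. u \<in> F \<and> v \<in> F} \<le> diss_max (card (far A v) - card (nb (far A v) u))"
proof -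
  let ?R = "nb A v \<union> nb A u"
  have fin: "finite A" using assms by (simp add: bounded_below_def)
  have uv: "adj v u" "adj u v" "u \<in> A" using assms sym[of v u] by (auto simp: nb_def)
  have "card {F \<in> MDS A. u \<in> F \<and> v \<in> F} \<le> phi (A - ?R) adj"
  proof (rule card_MDS_restrict_phi[OF fin, of "{u, v}"])
    fix F assume F: "F \<in> {F \<in> MDS A. u \<in> F \<and> v \<in> F}"
    then have "diss F" "F \<subseteq> A" using fin by (auto simp: MDS_iff)
    then have "x = u \<or> x = v" if "x \<in> F" "x \<in> ?R" for x
      using that F uv unfolding diss_def nb_def by blast
    then show "F \<in> MDS A \<and> F \<inter> ?R = {u, v}" using F uv assms(2) by (auto simp: nb_def)
  qed (auto simp: nb_def)
  also have "\<dots> \<le> diss_max (card (A - ?R))"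
    using assms(2,3) uv by (intro bounded_belowD[OF assms(1)]) (auto simp: nb_def)
  finally show ?thesis using card_Diff_nb_Un[OF fin assms(2,3)] by simp
qed

section \<open>Sets in which a given vertex is isolated\<close>

lemma iso_restrict:
  assumes "finite A" "F \<in> iso_MDS A v"
  shows "F - insert v (nb A v) \<in> MDS (far A v)" "F \<inter> insert v (nb A v) = {v}"
    "F - insert v (nb A v) = F - {v}"
proof -
  have F: "F \<in> MDS A" "v \<in> F" "\<And>x. x \<in> F \<Longrightarrow> \<not> adj v x"
    using assms(2) by (auto simp: iso_MDS_def paired_def)
  show eq: "F \<inter> insert v (nb A v) = {v}" using F(2,3) by (auto simp: nb_def)
  then show "F - insert v (nb A v) = F - {v}" by blast
  show "F - insert v (nb A v) \<in> MDS (far A v)"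
    unfolding far_def
  proof (rule MDS_restrict[OF assms(1) F(1)])
    fix s y assume "s \<in> F \<inter> insert v (nb A v)" "y \<in> A - insert v (nb A v)"
    then have "s = v" "y \<in> A" "y \<notin> nb A v" using eq by auto
    then show "\<not> adj s y" by (simp add: nb_def)
  qed
qed

lemma card_iso_restrict:
  assumes "finite A" "X \<subseteq> iso_MDS A v" and P: "\<And>F. F \<in> X \<Longrightarrow> P (F - {v})"
  shows "card X \<le> card {F \<in> MDS (far A v). P F}"
  unfolding far_def
proof (rule card_MDS_restrict[OF assms(1), of "{v}"])
  fix F assume "F \<in> X"
  then show "F \<in> MDS A \<and> F \<inter> insert v (nb A v) = {v} \<and> P (F - insert v (nb A v))"
    using iso_restrict[OF assms(1), of F v] assms(2) P[of F] by (auto simp: iso_MDS_def)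
qed (auto simp: nb_def)

lemma card_iso_le:
  assumes "bounded_below A" "v \<in> A"
  shows "card (iso_MDS A v) \<le> diss_max (card (far A v))"
proof -
  have "far A v \<subset> A" using assms(2) by (auto simp: far_def)
  then have "phi (far A v) adj \<le> diss_max (card (far A v))" using assms by (auto simp: bounded_below_def)
  then show ?thesis
    using card_iso_restrict[of A "iso_MDS A v" v "\<lambda>_. True"] assms by (simp add: phi_eq bounded_below_def)
qed

text \<open>The isolated \<open>v\<close> alone cannot block \<open>u\<close>. The blocker is a
  paired vertex, hence not \<open>v\<close>, or one of two neighbours of \<open>u\<close>, one of
  which is not \<open>v\<close>; it lies outside N[v] because \<open>v\<close> has no neighbour in
  \<open>F\<close>.\<close>

lemma iso_blocked:
  assumes "finite A" "F \<in> iso_MDS A v" "u \<in> nb A v"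
  shows "\<exists>w\<in>F. w \<in> nb (far A v) u"
proof -
  have F: "F \<in> MDS A" "v \<in> F" "\<not> paired F v" using assms by (auto simp: iso_MDS_def)
  have no: "x \<notin> nb A v" if "x \<in> F" for x using that F by (auto simp: nb_def paired_def)
  have u: "u \<in> A - F" using assms(3) no by (auto simp: nb_def)
  have "F \<subseteq> A" using F MDS_subset by blast
  then have *: "w \<in> nb (far A v) u" if "w \<in> F" "w \<noteq> v" "adj u w" for w
    using that no by (auto simp: nb_def far_def)
  from MDS_blocked[OF assms(1) F(1) u] show ?thesis
  proof
    assume "\<exists>w\<in>F. adj u w \<and> paired F w"
    then show ?thesis using * F(3) by blast
  next
    assume "\<exists>w\<in>F. \<exists>w'\<in>F. w \<noteq> w' \<and> adj u w \<and> adj u w'"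
    then show ?thesis using * by metis
  qed
qed

lemma isolated_in_MDS:
  assumes "finite A" "F \<in> MDS A" "w \<in> A" "nb A w = {}"
  shows "w \<in> F"
proof (rule ccontr)
  assume "w \<notin> F"
  then have "\<exists>u\<in>F. adj w u" using MDS_blocked[OF assms(1,2), of w] assms(3) by blast
  then show False using assms(2,4) MDS_subset by (auto simp: nb_def)
qed

text \<open>The vertex \<open>w\<close> that helps \<open>v\<close> to block \<open>u\<close> cannot
  be paired, so it is isolated as well. The sets through which \<open>u\<close> receives 1 from
  \<open>v\<close> can therefore be counted along such \<open>w\<close>.\<close>

lemma unpaired_at_iso:
  assumes "finite A" "F \<in> iso_MDS A v" "unpaired_at F u" "u \<in> nb A v"
  shows "\<exists>w\<in>nb (far A v) u. F - {v} \<in> iso_MDS (far A v) w"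
proof -
  obtain w where w: "w \<in> F" "w \<in> nb (far A v) u" using iso_blocked[OF assms(1,2,4)] by blast
  have "adj u w" "w \<noteq> v" using w by (auto simp: nb_def far_def)
  have "\<not> paired F w" using assms(3) w \<open>adj u w\<close> by (auto simp: unpaired_at_def)
  then have "F - {v} \<in> iso_MDS (far A v) w"
    using iso_restrict[OF assms(1,2)] w \<open>w \<noteq> v\<close> by (auto simp: iso_MDS_def paired_def)
  then show ?thesis using w by blast
qed

lemma card_through:
  assumes "finite A"
  shows "card {F \<in> MDS A. w \<in> F} \<le> card (iso_MDS A w) + (\<Sum>x\<in>nb A w. card {F \<in> MDS A. x \<in> F \<and> w \<in> F})"
proof -
  have "{F \<in> MDS A. w \<in> F} \<subseteq> iso_MDS A w \<union> (\<Union>x\<in>nb A w. {F \<in> MDS A. x \<in> F \<and> w \<in> F})"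
    using MDS_subset unfolding iso_MDS_def paired_def nb_def by blast
  then have "card {F \<in> MDS A. w \<in> F} \<le> card (iso_MDS A w \<union> (\<Union>x\<in>nb A w. {F \<in> MDS A. x \<in> F \<and> w \<in> F}))"
    using assms by (intro card_mono) (auto simp: finite_MDS finite_nb iso_MDS_def)
  also have "\<dots> \<le> card (iso_MDS A w) + card (\<Union>x\<in>nb A w. {F \<in> MDS A. x \<in> F \<and> w \<in> F})" by (rule card_Un_le)
  also have "card (\<Union>x\<in>nb A w. {F \<in> MDS A. x \<in> F \<and> w \<in> F}) \<le> (\<Sum>x\<in>nb A w. card {F \<in> MDS A. x \<in> F \<and> w \<in> F})"
    using assms by (intro card_UN_le finite_nb)
  finally show ?thesis by simp
qed

lemma card_through_le:
  assumes "bounded_below A" "w \<in> A"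
  shows "card {F \<in> MDS A. w \<in> F} \<le> (card (nb A w) + 1) * diss_max (card A - (card (nb A w) + 1))"
proof -
  have fin: "finite A" using assms by (simp add: bounded_below_def)
  have m: "card A - (card (nb A w) + 1) = card (far A w)" using card_eq_far[OF fin assms(2)] by simp
  have "card {F \<in> MDS A. x \<in> F \<and> w \<in> F} \<le> diss_max (card (far A w))" if "x \<in> nb A w" for x
    using pair_count[OF assms that] diss_max_mono by (meson diff_le_self order.trans)
  then have "(\<Sum>x\<in>nb A w. card {F \<in> MDS A. x \<in> F \<and> w \<in> F}) \<le> card (nb A w) * diss_max (card (far A w))"
    using sum_bounded_above[of "nb A w" _ "diss_max (card (far A w))"] by simp
  then show ?thesis using card_through[OF fin, of w] card_iso_le[OF assms] unfolding m by simp
qed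

text \<open>The second alternative arises for w of degree 2. If w has a single neighbour x, the third
  arises for x of degree at least 3 and the fourth for x of degree 2, where s - 1 is the remaining
  degree of the other neighbour of x. All other cases lead to the first alternative.\<close>
lemma through_bound:
  assumes bb: "bounded_below H" and w: "w \<in> H" "nb H w \<noteq> {}" and card: "card H = j + 4"
    and a: "a \<le> card {F \<in> MDS H. w \<in> F}"
  shows "7 * a \<le> 4 * diss_max (j + 4) \<or> a \<le> diss_max (j + 1) + 2 * diss_max j
    \<or> a \<le> diss_max (j + 2) + diss_max j
    \<or> (\<exists>s. 1 \<le> s \<and> s \<le> j + 2 \<and> a \<le> s * diss_max (j + 2 - s) + diss_max (j + 1))"
proof -
  have fin: "finite H" using bb by (simp add: bounded_below_def)
  define k where "k = card (nb H w)"
  define m where "m = card (far H w)"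
  define p where "p x = card {F \<in> MDS H. x \<in> F \<and> w \<in> F}" for x
  define e where "e x = card (nb (far H w) x)" for x
  have k: "1 \<le> k" using w fin by (simp add: k_def Suc_le_eq card_gt_0_iff finite_nb)
  have n: "j + 4 = k + 1 + m" using card_eq_far[OF fin w(1)] card by (simp add: k_def m_def)
  have p: "p x \<le> diss_max (m - e x)" if "x \<in> nb H w" for x
    using pair_count[OF bb w(1) that] by (simp add: p_def m_def e_def)
  have iso: "card (iso_MDS H w) \<le> diss_max m" using card_iso_le[OF bb w(1)] by (simp add: m_def)
  have a': "a \<le> card (iso_MDS H w) + (\<Sum>x\<in>nb H w. p x)"
    using a card_through[OF fin, of w] by (simp add: p_def)
  have em: "e x \<le> m" for x unfolding e_def m_def using fin by (intro card_mono finite_far nb_subset)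
  show ?thesis
  proof (cases "\<exists>x\<in>nb H w. nb (far H w) x = {}")
    case True
    then have "iso_MDS H w = {}" using iso_blocked[OF fin] by blast
    moreover have "(\<Sum>x\<in>nb H w. p x) \<le> k * diss_max m"
      using sum_bounded_above[of "nb H w" p "diss_max m"] p diss_max_mono[of "m - e x" m for x]
      by (simp add: k_def) (meson diff_le_self diss_max_mono order.trans)
    ultimately have "a \<le> k * diss_max m" using a' by simp
    moreover have eq: "j + 4 - k - 1 = m" using n by simp
    have "7 * (k * diss_max m) \<le> 4 * diss_max (j + 4)"
      by (rule numeric_closed_neighbour[of "j + 4" k, unfolded eq]) (use k n in auto)
    ultimately show ?thesis by linarith
  next
    case False
    then have e1: "1 \<le> e x" if "x \<in> nb H w" for x
      using that fin by (simp add: e_def Suc_le_eq card_gt_0_iff finite_nb finite_far)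
    obtain x0 where x0: "x0 \<in> nb H w" using w by blast
    have m1: "1 \<le> m" using e1[OF x0] em[of x0] by simp
    have "p x \<le> diss_max (m - 1)" if "x \<in> nb H w" for x
      using p[OF that] e1[OF that] diss_max_mono[of "m - e x" "m - 1"] by linarith
    then have "(\<Sum>x\<in>nb H w. p x) \<le> k * diss_max (m - 1)"
      using sum_bounded_above[of "nb H w" p "diss_max (m - 1)"] by (simp add: k_def)
    then have a2: "a \<le> diss_max m + k * diss_max (m - 1)" using a' iso by linarith
    consider "3 \<le> k" | "k = 2" | "k = 1" using k by linarith
    then show ?thesis
    proof cases
      case 1
      have eqs: "j + 4 - k - 1 = m" "j + 4 - k - 2 = m - 1" using n by simp_all
      have "7 * (diss_max m + k * diss_max (m - 1)) \<le> 4 * diss_max (j + 4)"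
        by (rule numeric_open_neighbours[of k "j + 4", unfolded eqs]) (use 1 n m1 in auto)
      with mult_le_mono2[OF a2, of 7] have "7 * a \<le> 4 * diss_max (j + 4)" by (rule order.trans)
      then show ?thesis by blast
    next
      case 2
      then have "m = j + 1" using n by simp
      then show ?thesis using a2 2 by simp
    next
      case 3
      then have mj: "m = j + 2" using n by simp
      obtain x where x: "nb H w = {x}" using 3 by (auto simp: k_def card_1_singleton_iff)
      have xw: "x \<in> H" "adj w x" using x by (auto simp: nb_def)
      have sum: "(\<Sum>x\<in>nb H w. p x) = p x" by (simp add: x)
      show ?thesis
      proof (cases "2 \<le> e x")
        case True
        then have "diss_max (m - e x) \<le> diss_max j" using mj by (intro diss_max_mono) simp
        then have "p x \<le> diss_max j" using p[of x] x by simp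
        then have "a \<le> diss_max (j + 2) + diss_max j" using a' iso sum mj by simp
        then show ?thesis by blast
      next
        case False
        then have ex: "e x = 1" using e1[of x] x by simp
        then have px: "p x \<le> diss_max (j + 1)" using p[of x] x mj by simp
        obtain y where y: "nb (far H w) x = {y}" using ex by (auto simp: e_def card_1_singleton_iff)
        let ?K = "far H w"
        have yK: "y \<in> ?K" using y by (auto simp: nb_def)
        have "?K \<subseteq> H" by (auto simp: far_def)
        then have bbK: "bounded_below ?K" using bb bounded_below_subset by blast
        \<comment> \<open>With \<open>w\<close> isolated its neighbour \<open>x\<close> must be
          blocked, and \<open>y\<close> is the only candidate. This turns the count into one of sets
          through \<open>y\<close> in \<open>?K\<close>.\<close>
        have "y \<in> F - {w}" if F: "F \<in> iso_MDS H w" for F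
        proof -
          obtain z where "z \<in> F" "z \<in> nb ?K x" using iso_blocked[OF fin F, of x] x by blast
          then show ?thesis using y yK by (auto simp: far_def)
        qed
        then have "card (iso_MDS H w) \<le> card {F \<in> MDS ?K. y \<in> F}"
          using card_iso_restrict[OF fin order.refl, of w "\<lambda>F. y \<in> F"] by blast
        also have "\<dots> \<le> (card (nb ?K y) + 1) * diss_max (card ?K - (card (nb ?K y) + 1))"
          by (rule card_through_le[OF bbK yK])
        finally have "a \<le> (card (nb ?K y) + 1) * diss_max (j + 2 - (card (nb ?K y) + 1)) + diss_max (j + 1)"
          using a' sum px mj m_def by simp
        moreover have "card (nb ?K y) + 1 \<le> j + 2"
          using card_eq_far[of ?K y] yK fin mj by (simp add: m_def finite_far)
        ultimately show ?thesis by (metis le_add2)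
      qed
    qed
  qed
qed

section \<open>The weight sent out by a vertex of a connected graph\<close>

definition conn :: "'a set \<Rightarrow> bool" where
  "conn A \<longleftrightarrow> (\<forall>B. B \<subset> A \<longrightarrow> B \<noteq> {} \<longrightarrow> (\<exists>x\<in>B. \<exists>y\<in>A - B. adj x y))"

text \<open>Equality has to be allowed for at most one non-neighbour: every vertex of a K_5^*
  attains it. Connectedness excludes the remaining ties, such as two disjoint copies of K_5, by
  giving some neighbour of \<open>v\<close> a neighbour beyond N[v] whenever \<open>v\<close> has
  non-neighbours.\<close>

lemma load_bound:
  assumes bb: "bounded_below A" and conn: "conn A" and v: "v \<in> A"
  shows "load A v \<le> 2 * diss_max (card A)"
    and "2 \<le> card (far A v) \<Longrightarrow> load A v < 2 * diss_max (card A)"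
proof -
  have fin: "finite A" using bb by (simp add: bounded_below_def)
  define H where "H = far A v"
  define N where "N = nb A v"
  define d where "d = card N"
  define m where "m = card H"
  define e where "e u = card (nb H u)" for u
  define a where "a = card (iso_MDS A v)"
  define b where "b u = card {F \<in> iso_MDS A v. unpaired_at F u}" for u
  \<comment> \<open>The edge \<open>uv\<close> dominates \<open>d + 1 + e u\<close> vertices, and \<open>b u\<close> counts the sets from which \<open>u\<close>
    receives 1 through the isolated vertex \<open>v\<close>.\<close>
  define t where "t u = (d + 1 + e u) * diss_max (m - e u) + b u" for u
  have H: "H = A - insert v N" by (simp add: H_def far_def N_def)
  have finN: "finite N" and finH: "finite H" using fin by (simp_all add: N_def finite_nb H_def finite_far)
  have NA: "N \<subseteq> A" "v \<notin> N" by (simp_all add: N_def nb_subset not_in_nb)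
  have HA: "H \<subseteq> A" by (simp add: H)
  have bbH: "bounded_below H" using bb HA bounded_below_subset by blast
  have n: "card A = d + 1 + m" using card_eq_far[OF fin v] by (simp add: d_def m_def N_def H_def)
  have "load A v \<le> (\<Sum>u\<in>N. card (nb A v \<union> nb A u) * card {F \<in> MDS A. u \<in> F \<and> v \<in> F} + b u) + 2 * a"
    using load_le[OF fin v] by (simp add: a_def b_def N_def)
  also have "(\<Sum>u\<in>N. card (nb A v \<union> nb A u) * card {F \<in> MDS A. u \<in> F \<and> v \<in> F} + b u) \<le> sum t N"
  proof (rule sum_mono)
    fix u assume u: "u \<in> N"
    have "card (nb A v \<union> nb A u) = d + 1 + e u"
      using card_nb_Un[OF fin v, of u] u by (simp add: d_def e_def N_def H_def)
    moreover have "card {F \<in> MDS A. u \<in> F \<and> v \<in> F} \<le> diss_max (m - e u)"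
      using pair_count[OF bb v, of u] u by (simp add: m_def e_def N_def H_def)
    ultimately show "card (nb A v \<union> nb A u) * card {F \<in> MDS A. u \<in> F \<and> v \<in> F} + b u \<le> t u"
      unfolding t_def by (intro add_right_mono mult_le_mono) simp_all
  qed
  finally have load: "load A v \<le> sum t N + 2 * a" by simp
  have b_le: "b u \<le> a" for u
    unfolding a_def b_def using fin by (intro card_mono) (auto simp: iso_MDS_def finite_MDS)
  have a_le: "a \<le> diss_max m" using card_iso_le[OF bb v] by (simp add: a_def m_def H_def)
  have e_le: "e u \<le> m" for u unfolding e_def m_def using finH by (intro card_mono nb_subset)
  have e_0: "e u = 0 \<longleftrightarrow> nb H u = {}" for u using finH by (simp add: e_def finite_nb)
  have sum_le: "sum t N \<le> d * T" if "\<And>u. u \<in> N \<Longrightarrow> t u \<le> T" for T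
    using sum_bounded_above[of N t T] that by (simp add: d_def)
  have sum_less: "sum t N < d * T" if "\<And>u. u \<in> N \<Longrightarrow> t u \<le> T" "u0 \<in> N" "t u0 < T" for T u0
  proof -
    have "sum t N < (\<Sum>u\<in>N. T)" using that finN by (intro sum_strict_mono_ex1) auto
    then show ?thesis by (simp add: d_def)
  qed
  have blocked: "\<exists>w\<in>F. w \<in> nb H u" if "F \<in> iso_MDS A v" "u \<in> N" for F u
    using iso_blocked[OF fin that(1), of u] that(2) by (simp add: H_def N_def)
  have sq: "(d + 1) * (d + 2) \<le> 2 * diss_max (d + 2)" "(d + 2) * (d + 3) \<le> 2 * diss_max (d + 3)"
    "(d + 3) * (d + 4) \<le> 2 * diss_max (d + 4)" "d * (d + 1) \<le> 2 * diss_max (d + 1)"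
    using sq_le_diss_max[of d] sq_le_diss_max[of "d + 1"] sq_le_diss_max[of "d + 2"] sq_le_diss_max[of "d + 3"]
    by (simp_all add: numeral_eq_Suc)
  have small: "diss_max k = 1" if "k \<le> 2" for k
  proof -
    have "k = 0 \<or> k = 1 \<or> k = 2" using that by linarith
    then show ?thesis by auto
  qed
  have "load A v \<le> 2 * diss_max (card A) \<and> (2 \<le> m \<longrightarrow> load A v < 2 * diss_max (card A))"
  proof (cases "d = 0")
    case True
    then have "N = {}" using finN by (simp add: d_def)
    have "A = {v}"
    proof (rule ccontr)
      assume "A \<noteq> {v}"
      then have "{v} \<subset> A" using v by blast
      then obtain y where "y \<in> A" "adj v y" using conn unfolding conn_def by blast
      then show False using \<open>N = {}\<close> by (auto simp: N_def nb_def)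
    qed
    then have "m = 0" by (simp add: m_def H)
    then show ?thesis using load a_le True n \<open>N = {}\<close> by simp
  next
    case d: False
    have escape: "\<exists>u\<in>N. nb H u \<noteq> {}" if "m \<noteq> 0"
    proof -
      have "H \<noteq> {}" using that by (auto simp: m_def)
      then have "insert v N \<subset> A" using v NA H by blast
      then obtain x y where "x \<in> insert v N" "y \<in> A - insert v N" and xy: "adj x y"
        using conn[unfolded conn_def, rule_format, of "insert v N"] by blast
      then have xy: "x \<in> insert v N" "y \<in> H" "adj x y" using H by simp_all
      have "x \<noteq> v" using xy H by (auto simp: N_def nb_def)
      then show ?thesis using xy by (auto simp: nb_def)
    qed
    show ?thesis
    proof (cases "\<exists>u\<in>N. nb H u = {}")
      case True
      then obtain u0 where u0: "u0 \<in> N" "nb H u0 = {}" by blast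
      then have "iso_MDS A v = {}" using blocked by blast
      then have a0: "a = 0" and b0: "b u = 0" for u by (simp_all add: a_def b_def)
      consider "m = 0" | "m = 1 \<or> m = 2" | "3 \<le> m" by linarith
      then show ?thesis
      proof cases
        case 1
        have "t u \<le> d + 1" for u using e_le[of u] by (simp add: t_def b0 1)
        then have "load A v \<le> d * (d + 1)" using sum_le[of "d + 1"] load a0 by simp
        then show ?thesis using sq(4) n 1 by simp
      next
        case 2
        have "t u \<le> d + 1 + m" for u
          using e_le[of u] small[of "m - e u"] 2 by (auto simp: t_def b0)
        then have "load A v \<le> d * (d + 1 + m)" using sum_le[of "d + 1 + m"] load a0 by simp
        moreover have "d * (d + 1 + m) < 2 * diss_max (card A)"
        proof (cases "m = 1")
          case True
          then show ?thesis using sq(1) by (simp add: n algebra_simps)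
        next
          case False
          then have "m = 2" using 2 by simp
          moreover have "d + 1 + 2 = d + 3" by simp
          ultimately show ?thesis using sq(2) by (simp only: n) (simp add: algebra_simps)
        qed
        ultimately show ?thesis by simp
      next
        case 3
        then have "m \<noteq> 0" by simp
        then obtain u1 where u1: "u1 \<in> N" "nb H u1 \<noteq> {}" using escape by blast
        then have "card {u0, u1} \<le> card N" using u0 finN by (intro card_mono) auto
        moreover have "u0 \<noteq> u1" using u0 u1 by blast
        \<comment> \<open>One neighbour escapes beyond N[v] and another does not, so there are two.
          The trade-off needs \<open>d + 1\<close> to be at least 3.\<close>
        ultimately have d2: "2 \<le> d" by (simp add: d_def)
        have "t u \<le> (d + 1) * diss_max m" for u
          using weighted_diss_max_le[of "d + 1" m "e u"] 3 d2 e_le[of u] by (simp add: t_def b0)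
        moreover have "t u1 < (d + 1) * diss_max m"
          using weighted_diss_max_less[of "d + 1" m "e u1"] 3 d2 e_le[of u1] u1 e_0[of u1] by (simp add: t_def b0)
        ultimately have "sum t N < d * ((d + 1) * diss_max m)" using sum_less u1 by blast
        also have "\<dots> = d * (d + 1) * diss_max m" by (simp only: mult.assoc)
        also have "\<dots> \<le> 2 * diss_max (d + 1) * diss_max m" using sq(4) by (rule mult_le_mono1)
        also have "\<dots> \<le> 2 * diss_max (card A)" using diss_max_supermult[of "d + 1" m] n by simp
        finally show ?thesis using load a0 by simp
      qed
    next
      case False
      have e1: "1 \<le> e u" if "u \<in> N" for u using that False e_0[of u] by (cases "e u") auto
      have "N \<noteq> {}" using d by (auto simp: d_def)
      then obtain u0 where u0: "u0 \<in> N" by blast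
      have m1: "1 \<le> m" using e1[OF u0] e_le[of u0] by simp
      \<comment> \<open>Too few vertices are left for the trade-off, but since every neighbour
        escapes, at most two remain undominated, where \<open>diss_max\<close> is 1.\<close>
      have tiny: "load A v \<le> d * (d + 1 + m + diss_max m) + 2 * diss_max m" if "m \<le> 3"
      proof -
        have "t u \<le> d + 1 + m + diss_max m" if "u \<in> N" for u
        proof -
          have "diss_max (m - e u) = 1" using small[of "m - e u"] e1[OF that] \<open>m \<le> 3\<close> by simp
          then show ?thesis using e_le[of u] b_le[of u] a_le by (simp add: t_def)
        qed
        then have "sum t N \<le> d * (d + 1 + m + diss_max m)" by (rule sum_le)
        then show ?thesis using load a_le by linarith
      qed
      consider "m = 1" | "m = 2" | "m = 3" | "4 \<le> m" using m1 by linarith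
      then show ?thesis
      proof cases
        case 1
        \<comment> \<open>The bound is exactly \<open>(d + 1) * (d + 2)\<close>, so equality is not
          excluded with a single non-neighbour.\<close>
        then show ?thesis using tiny sq(1) by (simp add: n algebra_simps)
      next
        case 2
        then have "load A v \<le> d * d + 4 * d + 2" using tiny by (simp add: algebra_simps)
        moreover have "d * d + 5 * d + 6 \<le> 2 * diss_max (d + 3)" using sq(2) by (simp add: algebra_simps)
        moreover have "card A = d + 3" using n 2 by simp
        ultimately show ?thesis by simp
      next
        case 3
        then have "load A v \<le> d * d + 7 * d + 6" using tiny by (simp add: algebra_simps)
        moreover have "d * d + 7 * d + 12 \<le> 2 * diss_max (d + 4)" using sq(3) by (simp add: algebra_simps)
        moreover have "card A = d + 4" using n 3 by simp
        ultimately show ?thesis by simp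
      next
        case 4
        then obtain j where j: "m = j + 4" by (metis add.commute le_iff_add)
        have m': "m - 1 = j + 3" "m - 2 = j + 2" using j by simp_all
        have n': "card A = j + 5 + d" using n j by simp
        \<comment> \<open>Every edge at \<open>v\<close> dominates at least one non-neighbour, so
          the trade-off starts from \<open>d + 2\<close> rewarded and \<open>j + 3\<close> remaining
          vertices and is applied to the other \<open>e u - 1\<close>.\<close>
        have t1: "t u \<le> (d + 2) * diss_max (j + 3) + b u" if "u \<in> N" for u
        proof -
          have "(d + 2 + (e u - 1)) * diss_max (j + 3 - (e u - 1)) \<le> (d + 2) * diss_max (j + 3)"
            using d e_le[of u] j e1[OF that] by (intro weighted_diss_max_le) auto
          moreover have "d + 2 + (e u - 1) = d + 1 + e u" "j + 3 - (e u - 1) = m - e u"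
            using e1[OF that] e_le[of u] j by simp_all
          ultimately show ?thesis by (simp add: t_def)
        qed
        have "load A v < 2 * diss_max (card A)"
        proof (cases "\<exists>u\<in>N. \<exists>w\<in>nb H u. nb H w = {}")
          case True
          then obtain u w where uw: "u \<in> N" "w \<in> nb H u" "nb H w = {}" by blast
          have wH: "w \<in> H" using uw nb_subset by blast
          \<comment> \<open>As \<open>w\<close> lies in every maximal dissociation set of \<open>H\<close>, it can be removed from \<open>H\<close>. The bound
            is then tight, and a further vertex escaping \<open>N[v] \<union> {w}\<close> makes it strict.\<close>
          have w_in: "w \<in> F" if "F \<in> MDS H" for F
            using isolated_in_MDS[OF finH that wH uw(3)] .
          have "phi H adj \<le> phi (H - {w}) adj"
            unfolding phi_eq[of H]
          proof (rule card_MDS_restrict_phi[OF finH, of "{w}"])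
            show "\<not> adj s y" if "s \<in> {w}" "y \<in> H - {w}" for s y
              using that uw(3) by (auto simp: nb_def)
          qed (use w_in in auto)
          also have "\<dots> \<le> diss_max (card (H - {w}))"
            using wH by (intro bounded_belowD[OF bbH]) blast
          also have "card (H - {w}) = j + 3" using wH j by (simp add: m_def)
          finally have phiH: "phi H adj \<le> diss_max (j + 3)" .
          have a1: "a \<le> diss_max (j + 3)"
            using card_iso_restrict[OF fin order.refl, of v "\<lambda>_. True"] phiH by (simp add: a_def phi_eq H_def)
          have t2: "t u \<le> (d + 3) * diss_max (j + 3)" if "u \<in> N" for u
            using t1[OF that] b_le[of u] a1 by (simp add: algebra_simps)
          let ?B = "insert w (insert v N)"
          have "insert v N \<union> H = A" using NA v by (auto simp: H)
          moreover have "H \<noteq> {w}" using 4 by (auto simp: m_def)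
          ultimately have "?B \<subset> A" using wH H by blast
          then obtain x y where xy: "x \<in> ?B" "y \<in> A - ?B" "adj x y"
            using conn[unfolded conn_def, rule_format, of ?B] by blast
          have yH: "y \<in> H" "y \<noteq> w" using xy H by auto
          have "x \<noteq> w" using xy(3) yH uw(3) by (auto simp: nb_def)
          moreover have "x \<noteq> v" using xy by (auto simp: N_def nb_def)
          ultimately have xN: "x \<in> N" using xy(1) by simp
          have yx: "y \<in> nb H x" using yH xy(3) by (simp add: nb_def)
          have "t x < (d + 3) * diss_max (j + 3)"
          proof (cases "e x = 1")
            case True
            then have eq: "nb H x = {y}" using yx by (auto simp: e_def card_1_singleton_iff)
            \<comment> \<open>A set counted by \<open>b x\<close> contains \<open>w\<close> and has
              \<open>y\<close> isolated; with both removed, at most \<open>j + 2\<close> vertices of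
              \<open>H\<close> are left to choose from.\<close>
            let ?R = "insert w (insert y (nb H y))"
            have "{F \<in> iso_MDS A v. unpaired_at F x} \<subseteq> iso_MDS A v" by blast
            moreover have "F - {v} \<in> iso_MDS H y" if "F \<in> {F \<in> iso_MDS A v. unpaired_at F x}" for F
              using unpaired_at_iso[OF fin, of F v x] that xN eq by (auto simp: N_def H_def)
            ultimately have "b x \<le> card {F \<in> MDS H. F \<in> iso_MDS H y}"
              unfolding b_def H_def by (intro card_iso_restrict[OF fin]) auto
            also have "\<dots> \<le> phi (H - ?R) adj"
            proof (rule card_MDS_restrict_phi[OF finH, of "{w, y}"])
              fix F assume "F \<in> {F \<in> MDS H. F \<in> iso_MDS H y}"
              then have F: "F \<in> MDS H" "y \<in> F" "\<not> paired F y" by (auto simp: iso_MDS_def)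
              then have "x \<notin> nb H y" if "x \<in> F" for x using that by (auto simp: nb_def paired_def)
              then show "F \<in> MDS H \<and> F \<inter> ?R = {w, y}" using F w_in[OF F(1)] by auto
            qed (use uw(3) in \<open>auto simp: nb_def\<close>)
            also have "\<dots> \<le> diss_max (card (H - ?R))"
              using wH by (intro bounded_belowD[OF bbH]) auto
            also have "\<dots> \<le> diss_max (card (H - {w, y}))"
              using finH by (intro diss_max_mono card_mono) auto
            also have "card (H - {w, y}) = j + 2"
              using wH yH finH j by (simp add: card_Diff_subset m_def)
            also have "diss_max (j + 2) < diss_max (j + 3)"
              using diss_max_gap1[of "j + 2"] diss_max_pos[of "j + 2"] by (simp add: numeral_eq_Suc)
            finally have "b x < diss_max (j + 3)" .
            then show ?thesis using t1[OF xN] by (simp add: algebra_simps)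
          next
            case False
            then have ex: "2 \<le> e x" using e1[OF xN] by simp
            have "(d + 2 + (e x - 1)) * diss_max (j + 3 - (e x - 1)) < (d + 2) * diss_max (j + 3)"
              using d e_le[of x] j ex by (intro weighted_diss_max_less) auto
            moreover have "d + 2 + (e x - 1) = d + 1 + e x" "j + 3 - (e x - 1) = m - e x"
              using ex e_le[of x] j by simp_all
            ultimately have "t x < (d + 2) * diss_max (j + 3) + b x" by (simp add: t_def)
            then show ?thesis using b_le[of x] a1 by (simp add: algebra_simps)
          qed
          then have "sum t N < d * ((d + 3) * diss_max (j + 3))" using sum_less[OF t2 xN] by blast
          then have "load A v < d * ((d + 3) * diss_max (j + 3)) + 2 * diss_max (j + 3)"
            using load a1 by linarith
          \<comment> \<open>This is twice the number of pairs among N[v] and \<open>w\<close>. The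
            non-strict version of the bound is what a separate component on these
            \<open>d + 2\<close> vertices would permit.\<close>
          also have "\<dots> = (d + 1) * (d + 2) * diss_max (j + 3)" by (simp add: algebra_simps)
          also have "\<dots> \<le> 2 * diss_max (d + 2) * diss_max (j + 3)" using sq(1) by (rule mult_le_mono1)
          also have "\<dots> \<le> 2 * diss_max (card A)"
            using diss_max_supermult[of "d + 2" "j + 3"] n' by (simp add: ac_simps)
          finally show ?thesis .
        next
          case noiso: False
          have t3: "t u \<le> (d + 2) * diss_max (j + 3) + a" if "u \<in> N" for u
            using t1[OF that] b_le[of u] by simp
          have load3: "load A v \<le> d * (d + 2) * diss_max (j + 3) + (d + 2) * a"
            using sum_le[OF t3] load by (simp add: algebra_simps)
          \<comment> \<open>From degree 6 on the crude bound for \<open>a\<close> suffices. Below, a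
            neighbour with a single escape improves the bound for \<open>a\<close>; if there is
            none, the bound for every \<open>t u\<close> improves.\<close>
          have "e u = 1 \<or> 2 \<le> e u" if "u \<in> N" for u using e1[OF that] by linarith
          then consider "6 \<le> d" | "d \<le> 5" "\<exists>u\<in>N. e u = 1" | "d \<le> 5" "\<forall>u\<in>N. 2 \<le> e u"
            by (cases "6 \<le> d") auto
          then show ?thesis
          proof cases
            case 1
            have "(d + 2) * a \<le> (d + 2) * diss_max (j + 4)" using a_le unfolding j by (rule mult_le_mono2)
            then show ?thesis using load3 numeric_large_degree[OF 1, of j] unfolding n' mult.assoc by linarith
          next
            case 2
            then obtain u w where u: "u \<in> N" and w: "nb H u = {w}" by (auto simp: e_def card_1_singleton_iff)
            have wH: "w \<in> H" "nb H w \<noteq> {}" using w u noiso by (auto simp: nb_def)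
            have "w \<in> F - {v}" if "F \<in> iso_MDS A v" for F
              using blocked[OF that u] w wH by (auto simp: H)
            then have a2: "a \<le> card {F \<in> MDS H. w \<in> F}"
              unfolding a_def H_def using card_iso_restrict[OF fin order.refl, of v "\<lambda>F. w \<in> F"] by blast
            have d5: "d \<in> {1,2,3,4,5}" using d 2 by auto
            have finish: "load A v < 2 * diss_max (card A)"
              if "a \<le> X" "d * (d + 2) * diss_max (j + 3) + (d + 2) * X < 2 * diss_max (j + 5 + d)" for X
              using order.trans[OF load3 add_left_mono[OF mult_le_mono2[OF that(1)]]] that(2)
              unfolding n' by (rule order.strict_trans1)
            from through_bound[OF bbH wH _ a2, of j] j consider
              "7 * a \<le> 4 * diss_max (j + 4)" | "a \<le> diss_max (j + 1) + 2 * diss_max j"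
              | "a \<le> diss_max (j + 2) + diss_max j"
              | s where "1 \<le> s" "s \<le> j + 2" "a \<le> s * diss_max (j + 2 - s) + diss_max (j + 1)"
              by (auto simp: m_def)
            then show ?thesis
            proof cases
              case 1
              have "7 * ((d + 2) * a) \<le> 4 * (d + 2) * diss_max (j + 4)"
                using mult_le_mono2[OF 1, of "d + 2"] by (simp only: mult.assoc mult.left_commute)
              then show ?thesis using load3 numeric_through_1[OF d5, of j] unfolding n' mult.assoc by linarith
            next
              case 2
              then show ?thesis using numeric_through_2[OF d5, of j] by (rule finish)
            next
              case 3
              then show ?thesis using numeric_through_3[OF d5, of j] by (rule finish)
            next
              case 4
              show ?thesis using 4(3) numeric_through_4[OF d5 4(1,2)] by (rule finish)
            qed
          next
            case 3
            have d5: "d \<in> {1,2,3,4,5}" using d 3 by auto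
            obtain T where T: "\<And>e b. 2 \<le> e \<Longrightarrow> e \<le> j + 4 \<Longrightarrow> b \<le> diss_max (j + 4) \<Longrightarrow> b \<le> e * diss_max (j + 2)
                \<Longrightarrow> (d + 1 + e) * diss_max (j + 4 - e) + b \<le> T"
              and T': "d * T + 2 * diss_max (j + 4) < 2 * diss_max (j + 5 + d)"
              using numeric_many_escapes[OF d5, of j] by blast
            have "t u \<le> T" if u: "u \<in> N" for u
              unfolding t_def j
            proof (rule T)
              show "2 \<le> e u" using 3 u by blast
              show "e u \<le> j + 4" using e_le[of u] j by simp
              show "b u \<le> diss_max (j + 4)" using b_le[of u] a_le j by simp
              \<comment> \<open>Each set counted by \<open>b u\<close> has one of the
                \<open>e u\<close> escapes \<open>w\<close> of \<open>u\<close> isolated. As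
                \<open>w\<close> has a neighbour in \<open>H\<close>, at most \<open>j + 2\<close>
                vertices of \<open>H\<close> are neither \<open>w\<close> nor adjacent to
                it.\<close>
              have "{F \<in> iso_MDS A v. unpaired_at F u} \<subseteq> iso_MDS A v" by blast
              moreover have "\<exists>w\<in>nb H u. F - {v} \<in> iso_MDS H w" if "F \<in> {F \<in> iso_MDS A v. unpaired_at F u}" for F
                using unpaired_at_iso[OF fin, of F v u] that u by (auto simp: N_def H_def)
              ultimately have "b u \<le> card {F \<in> MDS H. \<exists>w\<in>nb H u. F \<in> iso_MDS H w}"
                unfolding b_def H_def by (intro card_iso_restrict[OF fin]) auto
              also have "\<dots> \<le> card (\<Union>w\<in>nb H u. iso_MDS H w)"
                using finH by (intro card_mono) (auto simp: finite_nb iso_MDS_def finite_MDS)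
              also have "\<dots> \<le> (\<Sum>w\<in>nb H u. card (iso_MDS H w))" by (intro card_UN_le finite_nb finH)
              also have "\<dots> \<le> (\<Sum>w\<in>nb H u. diss_max (j + 2))"
              proof (rule sum_mono)
                fix w assume w: "w \<in> nb H u"
                then have wH: "w \<in> H" "nb H w \<noteq> {}" using u noiso nb_subset by blast+
                then have "card (nb H w) \<ge> 1" using finH by (simp add: Suc_le_eq card_gt_0_iff finite_nb)
                then have "card (far H w) \<le> j + 2" using card_eq_far[OF finH wH(1)] j by (simp add: m_def)
                then show "card (iso_MDS H w) \<le> diss_max (j + 2)"
                  using card_iso_le[OF bbH wH(1)] diss_max_mono by (meson order.trans)
              qed
              finally show "b u \<le> e u * diss_max (j + 2)" by (simp add: e_def)
            qed
            then have "sum t N \<le> d * T" by (rule sum_le)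
            then show ?thesis using load a_le T' n' j by simp
          qed
        qed
        then show ?thesis by simp
      qed
    qed
  qed
  then show "load A v \<le> 2 * diss_max (card A)"
    and "2 \<le> card (far A v) \<Longrightarrow> load A v < 2 * diss_max (card A)" by (auto simp: m_def H_def)
qed

section \<open>Complete graphs minus a matching\<close>

text \<open>Each vertex misses at most one other, which says that the complement is a matching
  without naming the set of deleted edges.\<close>

definition costar :: "'a set \<Rightarrow> bool" where
  "costar P \<longleftrightarrow> (\<forall>x\<in>P. \<forall>y\<in>P. \<forall>z\<in>P. y \<noteq> x \<longrightarrow> z \<noteq> x \<longrightarrow> \<not> adj x y \<longrightarrow> \<not> adj x z \<longrightarrow> y = z)"

lemma is_Kstar_iff: "is_Kstar adj P \<longleftrightarrow> costar P"
proof
  assume "is_Kstar adj P"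
  then obtain M where M: "\<forall>e1\<in>M. \<forall>e2\<in>M. e1 \<noteq> e2 \<longrightarrow> e1 \<inter> e2 = {}"
    and adj: "\<forall>x\<in>P. \<forall>y\<in>P. adj x y \<longleftrightarrow> x \<noteq> y \<and> {x, y} \<notin> M"
    unfolding is_Kstar_def by (elim exE conjE)
  show "costar P"
    unfolding costar_def
  proof (intro ballI impI)
    fix x y z assume xyz: "x \<in> P" "y \<in> P" "z \<in> P" "y \<noteq> x" "z \<noteq> x" "\<not> adj x y" "\<not> adj x z"
    then have "{x, y} \<in> M" "{x, z} \<in> M" using adj by metis+
    then have "{x, y} = {x, z}" using M[rule_format, of "{x, y}" "{x, z}"] by blast
    then show "y = z" using xyz by (metis doubleton_eq_iff)
  qed
next
  assume costar: "costar P"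
  let ?M = "{{x, y} |x y. x \<in> P \<and> y \<in> P \<and> x \<noteq> y \<and> \<not> adj x y}"
  have M: "\<exists>y. e = {c, y} \<and> c \<in> P \<and> y \<in> P \<and> y \<noteq> c \<and> \<not> adj c y" if "e \<in> ?M" "c \<in> e" for e c
  proof -
    obtain x y where xy: "e = {x, y}" "x \<in> P" "y \<in> P" "x \<noteq> y" "\<not> adj x y" using \<open>e \<in> ?M\<close> by blast
    have "\<not> adj y x" using sym[of y x] xy by blast
    then show ?thesis using xy \<open>c \<in> e\<close> by (cases "c = x") auto
  qed
  show "is_Kstar adj P"
    unfolding is_Kstar_def
  proof (intro exI[of _ ?M] conjI ballI impI)
    show "?M \<subseteq> {e. \<exists>x y. e = {x, y} \<and> x \<in> P \<and> y \<in> P \<and> x \<noteq> y}" by blast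
  next
    fix e f assume ef: "e \<in> ?M" "f \<in> ?M" "e \<noteq> f"
    show "e \<inter> f = {}"
    proof (rule ccontr)
      assume "e \<inter> f \<noteq> {}"
      then obtain c where "c \<in> e" "c \<in> f" by blast
      obtain y where y: "e = {c, y}" "c \<in> P" "y \<in> P" "y \<noteq> c" "\<not> adj c y"
        using M[OF ef(1) \<open>c \<in> e\<close>] by blast
      obtain z where z: "f = {c, z}" "z \<in> P" "z \<noteq> c" "\<not> adj c z"
        using M[OF ef(2) \<open>c \<in> f\<close>] by blast
      have "y = z" using costar y z unfolding costar_def by blast
      then show False using ef(3) y z by simp
    qed
  next
    fix x y assume "x \<in> P" "y \<in> P"
    moreover have "{x, y} \<notin> ?M" if "adj x y"
    proof
      assume "{x, y} \<in> ?M"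
      then obtain z where "{x, y} = {x, z}" "\<not> adj x z" using M[of "{x, y}" x] by blast
      then show False using that by (metis doubleton_eq_iff)
    qed
    ultimately show "adj x y \<longleftrightarrow> x \<noteq> y \<and> {x, y} \<notin> ?M" using irrefl by blast
  qed
qed

text \<open>Any two vertices form a dissociation set. Among three, at most one pair is non-adjacent,
  so some vertex has two neighbours.\<close>

lemma MDS_costar:
  assumes fin: "finite P" and costar: "costar P" and two: "2 \<le> card P"
  shows "MDS P = {F. F \<subseteq> P \<and> card F = 2}"
proof -
  have diss_small: "diss F" if "F \<subseteq> {x, y}" for F x y
    using that irrefl unfolding diss_def by blast
  have not_diss: "\<not> diss F" if F: "F \<subseteq> P" "x \<in> F" "y \<in> F" "z \<in> F" "x \<noteq> y" "x \<noteq> z" "y \<noteq> z" for F x y z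
  proof
    assume d: "diss F"
    have P: "x \<in> P" "y \<in> P" "z \<in> P" using F by auto
    have "\<not> (adj x y \<and> adj x z)" "\<not> (adj y x \<and> adj y z)" "\<not> (adj z x \<and> adj z y)"
      using d F unfolding diss_def by blast+
    moreover have "\<not> (\<not> adj x y \<and> \<not> adj x z)" "\<not> (\<not> adj y x \<and> \<not> adj y z)" "\<not> (\<not> adj z x \<and> \<not> adj z y)"
      using costar P F(5-7) unfolding costar_def by metis+
    ultimately show False using sym[of x y] sym[of y x] sym[of x z] sym[of z x] sym[of y z] sym[of z y] by argo
  qed
  have "F \<in> MDS P \<longleftrightarrow> F \<subseteq> P \<and> card F = 2" for F
  proof
    assume "F \<in> MDS P"
    then have F: "F \<subseteq> P" "diss F" "\<And>x. x \<in> P - F \<Longrightarrow> \<not> diss (insert x F)" using fin by (auto simp: MDS_iff)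
    have finF: "finite F" using F fin finite_subset by blast
    have "\<not> 3 \<le> card F"
    proof
      assume "3 \<le> card F"
      then obtain G where "G \<subseteq> F" "card G = 3" by (meson obtain_subset_with_card_n)
      then obtain x y z where "x \<in> F" "y \<in> F" "z \<in> F" "x \<noteq> y" "x \<noteq> z" "y \<noteq> z"
        by (auto simp: card_3_iff)
      then show False using not_diss F by blast
    qed
    moreover have "\<not> card F \<le> 1"
    proof
      assume le: "card F \<le> 1"
      then have "F \<noteq> P" using two by auto
      then obtain y where y: "y \<in> P - F" using F by blast
      have "\<exists>x. F \<subseteq> {x}" using le finF by (metis card_le_Suc0_iff_eq One_nat_def subsetI singletonI insertCI)
      then obtain x where "insert y F \<subseteq> {x, y}" by blast
      then show False using diss_small F(3)[OF y] by blast
    qed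
    ultimately show "F \<subseteq> P \<and> card F = 2" using F by simp
  next
    assume F: "F \<subseteq> P \<and> card F = 2"
    then obtain x y where xy: "F = {x, y}" "x \<noteq> y" by (auto simp: card_2_iff)
    have "\<not> diss (insert z F)" if "z \<in> P - F" for z
      using not_diss[of "insert z F" x y z] F xy that by auto
    then show "F \<in> MDS P" using F xy diss_small fin by (auto simp: MDS_iff)
  qed
  then show ?thesis by blast
qed

lemma phi_costar:
  assumes fin: "finite P" and costar: "costar P" and ne: "P \<noteq> {}"
  shows "phi P adj = Kstar_count (card P)"
proof (cases "card P = 1")
  case True
  then obtain x where P: "P = {x}" by (auto simp: card_1_singleton_iff)
  have "MDS P = {{x}}"
    using irrefl unfolding P by (auto simp: MDS_iff diss_def subset_singleton_iff)
  then show ?thesis using True by (simp add: phi_eq Kstar_count_def)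
next
  case False
  moreover have "card P \<noteq> 0" using fin ne by simp
  ultimately have "2 \<le> card P" by linarith
  then show ?thesis
    using MDS_costar[OF fin costar] n_subsets[OF fin, of 2] False by (simp add: phi_eq Kstar_count_def)
qed

section \<open>Disjoint unions of complete graphs minus matchings\<close>

definition costar_partition :: "'a set \<Rightarrow> 'a set set \<Rightarrow> bool" where
  "costar_partition A \<P> \<longleftrightarrow> partition_on A \<P> \<and> finite \<P> \<and>
      (\<forall>P\<in>\<P>. \<forall>Q\<in>\<P>. P \<noteq> Q \<longrightarrow> (\<forall>x\<in>P. \<forall>y\<in>Q. \<not> adj x y)) \<and> (\<forall>P\<in>\<P>. costar P)"

lemma is_union_Kstar_iff:
  "is_union_Kstar A adj S \<longleftrightarrow> (\<exists>\<P>. costar_partition A \<P> \<and> image_mset card (mset_set \<P>) = S)"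
  unfolding is_union_Kstar_def costar_partition_def is_Kstar_iff by blast

lemma phi_Union_costar:
  assumes "finite \<P>" "disjoint \<P>" "\<And>P. P \<in> \<P> \<Longrightarrow> finite P \<and> P \<noteq> {} \<and> costar P"
    and "\<And>P Q x y. P \<in> \<P> \<Longrightarrow> Q \<in> \<P> \<Longrightarrow> P \<noteq> Q \<Longrightarrow> x \<in> P \<Longrightarrow> y \<in> Q \<Longrightarrow> \<not> adj x y"
  shows "phi (\<Union>\<P>) adj = (\<Prod>P\<in>\<P>. Kstar_count (card P))"
  using assms
proof (induction \<P>)
  case empty
  then show ?case by (simp add: phi_eq MDS_empty)
next
  case (insert P \<P>)
  have "phi (\<Union>\<P>) adj = (\<Prod>P\<in>\<P>. Kstar_count (card P))"
  proof (rule insert.IH)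
    show "disjoint \<P>" using insert.prems(1) by (rule pairwise_subset) blast
  qed (use insert.prems in \<open>blast+\<close>)
  moreover have "phi (P \<union> \<Union>\<P>) adj = phi P adj * phi (\<Union>\<P>) adj"
  proof (rule phi_Un)
    have "P \<inter> Q = {}" if "Q \<in> \<P>" for Q
      using disjointD[OF insert.prems(1), of P Q] insert.hyps that by auto
    then show "P \<inter> \<Union>\<P> = {}" by blast
    show "\<not> adj x y" if xy: "x \<in> P" "y \<in> \<Union>\<P>" for x y
    proof -
      obtain Q where "Q \<in> \<P>" "y \<in> Q" using xy by blast
      then show ?thesis using insert.prems(3)[of P Q x y] insert.hyps xy by auto
    qed
  qed (use insert in auto)
  ultimately show ?case
    using insert.hyps phi_costar[of P] insert.prems(2)[of P] by simp
qed

lemma costar_partition_sizes: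
  assumes fin: "finite A" and P: "costar_partition A \<P>"
  defines "S \<equiv> image_mset card (mset_set \<P>)"
  shows "phi A adj = prod_mset (image_mset Kstar_count S)" "sum_mset S = card A"
    "\<And>m. m \<in># S \<Longrightarrow> 1 \<le> m"
proof -
  have *: "finite \<P>" "disjoint \<P>" "\<Union>\<P> = A" "{} \<notin> \<P>"
    using P by (auto simp: costar_partition_def partition_on_def)
  have **: "finite Q \<and> Q \<noteq> {} \<and> costar Q" if "Q \<in> \<P>" for Q
    using that * P fin unfolding costar_partition_def by (metis Union_upper finite_subset)
  have "phi (\<Union>\<P>) adj = (\<Prod>P\<in>\<P>. Kstar_count (card P))"
    by (rule phi_Union_costar[OF *(1,2) **]) (use P in \<open>auto simp: costar_partition_def\<close>)
  then show "phi A adj = prod_mset (image_mset Kstar_count S)"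
    by (simp add: S_def *(3) image_mset.compositionality comp_def prod_unfold_prod_mset)
  have "card (\<Union>\<P>) = sum card \<P>" by (rule card_Union_disjoint) (use * ** in auto)
  then show "sum_mset S = card A" by (simp add: S_def *(3) sum_unfold_sum_mset)
  show "1 \<le> m" if "m \<in># S" for m
    using that ** *(1) by (auto simp: S_def Suc_le_eq card_gt_0_iff)
qed

lemma costar_partition_Un:
  assumes "costar_partition B \<P>" "costar_partition C \<Q>" "B \<inter> C = {}"
    and sep: "\<And>x y. x \<in> B \<Longrightarrow> y \<in> C \<Longrightarrow> \<not> adj x y"
  shows "costar_partition (B \<union> C) (\<P> \<union> \<Q>)"
proof -
  have subB: "P \<subseteq> B" if "P \<in> \<P>" for P
    using that assms(1) by (auto simp: costar_partition_def partition_on_def)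
  have subC: "Q \<subseteq> C" if "Q \<in> \<Q>" for Q
    using that assms(2) by (auto simp: costar_partition_def partition_on_def)
  have "partition_on (B \<union> C) (\<P> \<union> \<Q>)"
    using assms(1-3) by (auto simp: costar_partition_def partition_on_def intro!: disjoint_union)
  moreover have "\<not> adj x y" if "P \<in> \<P> \<union> \<Q>" "Q \<in> \<P> \<union> \<Q>" "P \<noteq> Q" "x \<in> P" "y \<in> Q" for P Q x y
  proof -
    note asm = that
    consider "P \<in> \<P>" "Q \<in> \<P>" | "P \<in> \<Q>" "Q \<in> \<Q>" | "x \<in> B" "y \<in> C" | "x \<in> C" "y \<in> B"
      using asm(1,2,4,5) subB[of P] subB[of Q] subC[of P] subC[of Q] by blast
    then show ?thesis
    proof cases
      case 4
      then show ?thesis using sep[of y x] sym[of x y] by blast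
    qed (use that assms(1,2) sep in \<open>auto simp: costar_partition_def\<close>)
  qed
  ultimately show ?thesis using assms(1,2) unfolding costar_partition_def by auto
qed

text \<open>The equality clause asserts a partition without its sizes. In this form it holds for
  every cardinality, also below 8, and can be put together from the two sides of a disconnected
  graph.\<close>

theorem phi_le_diss_max:
  assumes "finite A"
  shows "phi A adj \<le> diss_max (card A) \<and> (phi A adj = diss_max (card A) \<longrightarrow> (\<exists>\<P>. costar_partition A \<P>))"
  using assms
proof (induction A rule: finite_psubset_induct)
  case (psubset A)
  show ?case
  proof (cases "conn A")
    case True
    have bb: "bounded_below A" using psubset unfolding bounded_below_def by blast
    show ?thesis
    proof (cases "A = {}")
      case True
      moreover have "costar_partition {} {}" by (auto simp: costar_partition_def partition_on_def)
      ultimately show ?thesis by (auto simp: phi_eq MDS_empty)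
    next
      case False
      have load: "2 * card A * phi A adj \<le> (\<Sum>v\<in>A. load A v)" using psubset(1) by (rule phi_le_sum_load)
      have "(\<Sum>v\<in>A. load A v) \<le> (\<Sum>v\<in>A. 2 * diss_max (card A))"
        by (rule sum_mono) (rule load_bound(1)[OF bb True])
      also have "\<dots> = 2 * card A * diss_max (card A)" by simp
      finally have "2 * card A * phi A adj \<le> 2 * card A * diss_max (card A)" using load by (rule order.trans[rotated])
      then have le: "phi A adj \<le> diss_max (card A)" using False psubset(1) by (simp add: card_gt_0_iff)
      have "costar_partition A {A}" if eq: "phi A adj = diss_max (card A)"
      proof -
        have far: "card (far A v) \<le> 1" if v: "v \<in> A" for v
        proof (rule ccontr)
          assume "\<not> card (far A v) \<le> 1"
          \<comment> \<open>One strict load makes the total strictly too small, so equality leaves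
            every vertex at most one non-neighbour.\<close>
          then have "load A v < 2 * diss_max (card A)" using load_bound(2)[OF bb True v] by simp
          then have "(\<Sum>v\<in>A. load A v) < (\<Sum>v\<in>A. 2 * diss_max (card A))"
            using v load_bound(1)[OF bb True] psubset(1) by (intro sum_strict_mono_ex1) auto
          then show False using load eq by (simp add: ac_simps)
        qed
        have "costar A"
          unfolding costar_def
        proof (intro ballI impI)
          fix x y z assume xyz: "x \<in> A" "y \<in> A" "z \<in> A" "y \<noteq> x" "z \<noteq> x" "\<not> adj x y" "\<not> adj x z"
          then have "y \<in> far A x" "z \<in> far A x" by (auto simp: far_def nb_def)
          moreover have "card (far A x) \<le> Suc 0" "finite (far A x)"
            using far[OF xyz(1)] finite_far[OF psubset(1)] by simp_all
          ultimately show "y = z" by (simp add: card_le_Suc0_iff_eq)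
        qed
        then show ?thesis using False by (auto simp: costar_partition_def partition_on_def disjoint_def)
      qed
      then show ?thesis using le by blast
    qed
  next
    case False
    then obtain B where B: "B \<subset> A" "B \<noteq> {}" "\<And>x y. x \<in> B \<Longrightarrow> y \<in> A - B \<Longrightarrow> \<not> adj x y"
      unfolding conn_def by blast
    let ?C = "A - B"
    have C: "?C \<subset> A" using B by blast
    have fin: "finite B" "finite ?C" using psubset(1) B finite_subset by auto
    have "B \<union> ?C = A" using B by blast
    then have phi: "phi A adj = phi B adj * phi ?C adj" using phi_Un[OF fin _ B(3)] by auto
    have card: "card A = card B + card ?C" using B psubset(1) by (simp add: card_Diff_subset fin card_mono psubset_imp_subset)
    have IH: "phi B adj \<le> diss_max (card B)" "phi ?C adj \<le> diss_max (card ?C)"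
      "phi B adj = diss_max (card B) \<Longrightarrow> \<exists>\<P>. costar_partition B \<P>"
      "phi ?C adj = diss_max (card ?C) \<Longrightarrow> \<exists>\<P>. costar_partition ?C \<P>"
      using psubset(2)[OF B(1)] psubset(2)[OF C] by auto
    have sup: "diss_max (card B) * diss_max (card ?C) \<le> diss_max (card A)"
      unfolding card by (rule diss_max_supermult)
    have "phi A adj \<le> diss_max (card B) * diss_max (card ?C)" unfolding phi by (intro mult_le_mono IH)
    then have le: "phi A adj \<le> diss_max (card A)" using sup by linarith
    moreover have "\<exists>\<P>. costar_partition A \<P>" if eq: "phi A adj = diss_max (card A)"
    proof -
      have "phi B adj = diss_max (card B)"
      proof (rule ccontr)
        assume "phi B adj \<noteq> diss_max (card B)"
        then have "phi B adj * diss_max (card ?C) < diss_max (card B) * diss_max (card ?C)"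
          using IH(1) diss_max_pos by simp
        moreover have "phi A adj \<le> phi B adj * diss_max (card ?C)" unfolding phi using IH(2) by (rule mult_le_mono2)
        ultimately show False using sup eq by linarith
      qed
      moreover have "phi ?C adj = diss_max (card ?C)"
      proof (rule ccontr)
        assume "phi ?C adj \<noteq> diss_max (card ?C)"
        then have "diss_max (card B) * phi ?C adj < diss_max (card B) * diss_max (card ?C)"
          using IH(2) diss_max_pos by simp
        moreover have "phi A adj \<le> diss_max (card B) * phi ?C adj" unfolding phi using IH(1) by (rule mult_le_mono1)
        ultimately show False using sup eq by linarith
      qed
      ultimately obtain \<P> \<Q> where "costar_partition B \<P>" "costar_partition ?C \<Q>" using IH by blast
      then have "costar_partition (B \<union> ?C) (\<P> \<union> \<Q>)" by (rule costar_partition_Un) (use B(3) in auto)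
      then show ?thesis using \<open>B \<union> ?C = A\<close> by auto
    qed
    ultimately show ?thesis by blast
  qed
qed

text \<open>For any partition into such parts \<open>phi\<close> is a product determined by the
  sizes, so equality is a matter of arithmetic. The partition comes from equality in one direction
  and from \<open>is_union_Kstar\<close> in the other.\<close>

lemma phi_extremal:
  assumes "finite A" "8 \<le> 5 * t + r" "r < 5" "card A = 5 * t + r"
  shows "phi A adj \<le> diss_max (card A) \<and>
    (phi A adj = diss_max (card A) \<longleftrightarrow> is_union_Kstar A adj (extremal_sizes t r))"
proof -
  have iff: "phi A adj = diss_max (card A) \<longleftrightarrow> image_mset card (mset_set \<P>) = extremal_sizes t r"
    if "costar_partition A \<P>" for \<P>
    using costar_partition_sizes[OF assms(1) that] extremal_sizes_iff[of "image_mset card (mset_set \<P>)" t r] assms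
    by simp
  then show ?thesis
    using phi_le_diss_max[OF assms(1)] unfolding is_union_Kstar_iff by blast
qed

end

theorem theorem5p1:
  fixes V :: "'a set" and adj :: "'a \<Rightarrow> 'a \<Rightarrow> bool" and t r :: nat
  assumes "simple_graph V adj"
    and "card V \<ge> 8"
    and "card V = 5 * t + r" and "t > 0" and "r < 5"
  shows "(r = 0 \<longrightarrow> phi V adj \<le> 10 ^ t \<and>
            (phi V adj = 10 ^ t \<longleftrightarrow> is_union_Kstar V adj (replicate_mset t 5)))
       \<and> (r = 1 \<longrightarrow> phi V adj \<le> 15 * 10 ^ (t - 1) \<and>
            (phi V adj = 15 * 10 ^ (t - 1) \<longleftrightarrow>
               is_union_Kstar V adj ({#6#} + replicate_mset (t - 1) 5)))
       \<and> (r = 2 \<longrightarrow> phi V adj \<le> 225 * 10 ^ (t - 2) \<and>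
            (phi V adj = 225 * 10 ^ (t - 2) \<longleftrightarrow>
               is_union_Kstar V adj (replicate_mset 2 6 + replicate_mset (t - 2) 5)))
       \<and> (r = 3 \<longrightarrow> phi V adj \<le> 36 * 10 ^ (t - 1) \<and>
            (phi V adj = 36 * 10 ^ (t - 1) \<longleftrightarrow>
               is_union_Kstar V adj (replicate_mset 2 4 + replicate_mset (t - 1) 5)))
       \<and> (r = 4 \<longrightarrow> phi V adj \<le> 6 * 10 ^ t \<and>
            (phi V adj = 6 * 10 ^ t \<longleftrightarrow>
               is_union_Kstar V adj ({#4#} + replicate_mset t 5)))"
proof -
  interpret sgraph adj
    by standard (use assms(1) in \<open>auto simp: simple_graph_def\<close>)
  have "finite V" using assms(1) by (simp add: simple_graph_def)
  have n8: "8 \<le> 5 * t + r" using assms by simp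
  show ?thesis
    using phi_extremal[OF \<open>finite V\<close> n8 assms(5,3)] diss_max_residue[OF n8]
    unfolding assms(3) extremal_sizes_def by (intro conjI impI; simp)
qed

end
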